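(* Let $N\ge1$, let $a_1,\dots,a_N\in\mathbb R$ with $0<|a_i|<1$, and let $\sigma(x,y)$, $q_r$, $\tilde q_t$, $p^k_{r,m}$, $\tilde p^l_{n,t}$ be as defined in the context. Then there are constants $a_{s,j},b_{s,j},\tilde a_{s,j},\tilde b_{s,j}$ (depending only on the indices shown and on $a_1,\dots,a_N$) such that the following holds for all $n>2N$ and $m>2N$. For $2N\le r\le n$ and $0\le k\le m$, $$p^k_{r,m}(x,y)=\begin{cases} q_r(x,y)U_k(y), & k\le m-N,\\[4pt] \displaystyle\sum_{j=0}^{k-(m-N)-1}\left\{a_{m-k,j}\,q_{r+j}(x,y)U_{k-j}(y)+b_{m-k,j}\,\tilde q_{m+1+j}(x,y)U_{r+k-m-1-j}(x)\right\}, & k>m-N.\end{cases}$$ Likewise, for $2N\le t\le m$ and $0\le l\le n$, $$\tilde p^l_{n,t}(x,y)=\begin{cases} \tilde q_t(x,y)U_l(x), & l\le n-N,\\[4pt] \displaystyle\sum_{j=0}^{l-(n-N)-1}\left\{\tilde a_{n-l,j}\,\tilde q_{t+j}(x,y)U_{l-j}(x)+\tilde b_{n-l,j}\,q_{n+1+j}(x,y)U_{t+l-n-1-j}(y)\right\}, & l>n-N.\end{cases}$$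
   Context: Write $x=\frac12(z+1/z)$, $y=\frac12(w+1/w)$. Set $\omega(z,w)=\prod_{i=1}^N(1+a_izw)$, $$h(z,y)=\omega(z,w)\omega(z,1/w)=\sum_{i=0}^{2N}h_i(y)z^i,\qquad \tilde h(x,w)=\omega(z,w)\omega(1/z,w)=\sum_{j=0}^{2N}\tilde h_j(x)w^j,$$ where the $h_i$ are polynomials in $y$ and the $\tilde h_j$ polynomials in $x$. The weight on $[-1,1]^2$ is $$\sigma(x,y)=\frac{4}{\pi^2}\frac{\sqrt{1-x^2}\sqrt{1-y^2}}{|h(z,y)|^2}=\frac{4}{\pi^2}\frac{\sqrt{1-x^2}\sqrt{1-y^2}}{|\tilde h(x,w)|^2},\qquad |z|=|w|=1,$$ and $d\mu=\sigma\,dx\,dy$. $U_n$ is the Chebyshev polynomial of the second kind, with $U_n=-U_{-n-2}$ for $n<0$. Define $q_r(x,y)=\sum_{i=0}^{2N}h_i(y)U_{r-i}(x)$ and $\tilde q_t(x,y)=\sum_{j=0}^{2N}\tilde h_j(x)U_{t-j}(y)$. Lexicographical ordering: $(i,j)<_{\rm lex}(i_1,j_1)$ iff $i<i_1$, or $i=i_1$ and $j<j_1$. Reverse lexicographical ordering: $(i,j)<_{\rm revlex}(i_1,j_1)$ iff $(j,i)<_{\rm lex}(j_1,i_1)$. For $0\le k\le m$, $p^k_{r,m}$ is the unique polynomial which is a linear combination of the monomials $x^iy^j$ with $0\le j\le m$ and $(i,j)\le_{\rm lex}(r,k)$, has positive coefficient of $x^ry^k$, has $\int (p^k_{r,m})^2d\mu=1$,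 and is orthogonal with respect to $\mu$ to all $x^iy^j$ with $0\le i<r,\ 0\le j\le m$ or $i=r,\ 0\le j<k$. For $0\le l\le n$, $\tilde p^l_{n,t}$ is the unique polynomial which is a linear combination of the monomials $x^iy^j$ with $0\le i\le n$ and $(i,j)\le_{\rm revlex}(l,t)$, has positive coefficient of $x^ly^t$, has $\int(\tilde p^l_{n,t})^2d\mu=1$, and is orthogonal with respect to $\mu$ to all $x^iy^j$ with $0\le j<t,\ 0\le i\le n$ or $j=t,\ 0\le i<l$. *)

theory Defs
  imports "HOL-Analysis.Analysis" "HOL-Computational_Algebra.Polynomial"
begin

section \<open>Chebyshev polynomials of the second kind\<close>

fun cheb_U_nat :: "nat \<Rightarrow> real poly" where
  "cheb_U_nat 0 = 1"
| "cheb_U_nat (Suc 0) = [:0, 2:]"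
| "cheb_U_nat (Suc (Suc n)) = [:0, 2:] * cheb_U_nat (Suc n) - cheb_U_nat n"

text \<open>Extension to all integer indices by \<open>U\<^sub>n = - U\<^sub>-\<^sub>n\<^sub>-\<^sub>2\<close>; at \<open>n = -1\<close> this rule reads
  \<open>U\<^sub>-\<^sub>1 = - U\<^sub>-\<^sub>1\<close>, i.e. \<open>U\<^sub>-\<^sub>1 = 0\<close>.\<close>

definition cheb_U :: "int \<Rightarrow> real poly" where
  "cheb_U n =
     (if n \<ge> 0 then cheb_U_nat (nat n) else if n = -1 then 0 else - cheb_U_nat (nat (- n - 2)))"

lemma cheb_U_neg: "n < 0 \<Longrightarrow> cheb_U n = - cheb_U (- n - 2)"
  by (auto simp: cheb_U_def)

abbreviation U :: "int \<Rightarrow> real \<Rightarrow> real" where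
  "U n x \<equiv> poly (cheb_U n) x"


section \<open>The polynomials \<open>h\<^sub>i\<close> and their counterparts in \<open>x\<close>\<close>

abbreviation cpoly :: "real poly \<Rightarrow> complex \<Rightarrow> complex" where
  "cpoly p \<equiv> poly (map_poly complex_of_real p)"

definition omega :: "nat \<Rightarrow> (nat \<Rightarrow> real) \<Rightarrow> complex \<Rightarrow> complex \<Rightarrow> complex" where
  "omega N a z w = (\<Prod>i=1..N. 1 + of_real (a i) * z * w)"

definition is_h_coeffs :: "nat \<Rightarrow> (nat \<Rightarrow> real) \<Rightarrow> (nat \<Rightarrow> real poly) \<Rightarrow> bool" where
  "is_h_coeffs N a H \<longleftrightarrow>
     (\<forall>i>2*N. H i = 0) \<and>
     (\<forall>z w. w \<noteq> 0 \<longrightarrow>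
        omega N a z w * omega N a z (1/w) = (\<Sum>i=0..2*N. cpoly (H i) ((w + 1/w) / 2) * z ^ i))"

definition is_ht_coeffs :: "nat \<Rightarrow> (nat \<Rightarrow> real) \<Rightarrow> (nat \<Rightarrow> real poly) \<Rightarrow> bool" where
  "is_ht_coeffs N a H \<longleftrightarrow>
     (\<forall>j>2*N. H j = 0) \<and>
     (\<forall>z w. z \<noteq> 0 \<longrightarrow>
        omega N a z w * omega N a (1/z) w = (\<Sum>j=0..2*N. cpoly (H j) ((z + 1/z) / 2) * w ^ j))"

text \<open>Both expansions exist and are unique: see \<open>ex1_h_coeffs\<close> and \<open>ex1_ht_coeffs\<close> below.\<close>

definition h_coeff :: "nat \<Rightarrow> (nat \<Rightarrow> real) \<Rightarrow> nat \<Rightarrow> real poly" where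
  "h_coeff N a = (THE H. is_h_coeffs N a H)"

definition ht_coeff :: "nat \<Rightarrow> (nat \<Rightarrow> real) \<Rightarrow> nat \<Rightarrow> real poly" where
  "ht_coeff N a = (THE H. is_ht_coeffs N a H)"

definition h :: "nat \<Rightarrow> (nat \<Rightarrow> real) \<Rightarrow> complex \<Rightarrow> complex \<Rightarrow> complex" where
  "h N a z y = (\<Sum>i=0..2*N. cpoly (h_coeff N a i) y * z ^ i)"

definition ht :: "nat \<Rightarrow> (nat \<Rightarrow> real) \<Rightarrow> complex \<Rightarrow> complex \<Rightarrow> complex" where
  "ht N a x w = (\<Sum>j=0..2*N. cpoly (ht_coeff N a j) x * w ^ j)"

definition q :: "nat \<Rightarrow> (nat \<Rightarrow> real) \<Rightarrow> nat \<Rightarrow> real \<Rightarrow> real \<Rightarrow> real" where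
  "q N a r x y = (\<Sum>i=0..2*N. poly (h_coeff N a i) y * U (int r - int i) x)"

definition qt :: "nat \<Rightarrow> (nat \<Rightarrow> real) \<Rightarrow> nat \<Rightarrow> real \<Rightarrow> real \<Rightarrow> real" where
  "qt N a t x y = (\<Sum>j=0..2*N. poly (ht_coeff N a j) x * U (int t - int j) y)"


section \<open>The weight and the measure\<close>

text \<open>For \<open>x \<in> [-1,1]\<close> the point \<open>z = cis (arccos x)\<close> satisfies \<open>|z| = 1\<close> and
  \<open>x = (z + 1/z) / 2\<close>. The only other such point is its conjugate; the choice is immaterial,
  and the expression through \<open>ht\<close> gives the same weight: see \<open>weight_eq\<close> below.\<close>

definition weight :: "nat \<Rightarrow> (nat \<Rightarrow> real) \<Rightarrow> real \<Rightarrow> real \<Rightarrow> real" where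
  "weight N a x y =
     4 / pi\<^sup>2 * (sqrt (1 - x\<^sup>2) * sqrt (1 - y\<^sup>2)) / (cmod (h N a (cis (arccos x)) (of_real y)))\<^sup>2"

definition mu :: "nat \<Rightarrow> (nat \<Rightarrow> real) \<Rightarrow> (real \<times> real) measure" where
  "mu N a = density lborel
     (\<lambda>(x, y). ennreal (indicator ({-1..1} \<times> {-1..1}) (x, y) * weight N a x y))"


section \<open>Orthonormal polynomials in two variables\<close>

text \<open>A polynomial in \<open>x, y\<close> is an element of \<open>real poly poly\<close> whose outer variable is \<open>x\<close> and
  whose coefficients are polynomials in \<open>y\<close>.\<close>

definition poly2 :: "real poly poly \<Rightarrow> real \<Rightarrow> real \<Rightarrow> real" where
  "poly2 p x y = poly (poly p [:x:]) y"

definition coeff2 :: "real poly poly \<Rightarrow> nat \<Rightarrow> nat \<Rightarrow> real" where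
  "coeff2 p i j = coeff (coeff p i) j"

lemma poly2_eq_sum:
  "poly2 p x y = (\<Sum>i\<le>degree p. \<Sum>j\<le>degree (coeff p i). coeff2 p i j * x ^ i * y ^ j)"
proof -
  have "poly2 p x y = (\<Sum>i\<le>degree p. poly (coeff p i) y * x ^ i)"
    unfolding poly2_def by (subst poly_altdef) (simp add: poly_sum)
  also have "\<dots> = (\<Sum>i\<le>degree p. \<Sum>j\<le>degree (coeff p i). coeff2 p i j * x ^ i * y ^ j)"
    by (intro sum.cong refl)
       (simp add: poly_altdef coeff2_def sum_distrib_left mult_ac)
  finally show ?thesis .
qed

definition lex_less :: "nat \<times> nat \<Rightarrow> nat \<times> nat \<Rightarrow> bool" where
  "lex_less u v \<longleftrightarrow> fst u < fst v \<or> fst u = fst v \<and> snd u < snd v"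

definition revlex_less :: "nat \<times> nat \<Rightarrow> nat \<times> nat \<Rightarrow> bool" where
  "revlex_less u v \<longleftrightarrow> lex_less (snd u, fst u) (snd v, fst v)"

definition is_lex_op ::
  "(real \<times> real) measure \<Rightarrow> nat \<Rightarrow> nat \<Rightarrow> nat \<Rightarrow> real poly poly \<Rightarrow> bool" where
  "is_lex_op M m r k p \<longleftrightarrow>
     (\<forall>i j. coeff2 p i j \<noteq> 0 \<longrightarrow> j \<le> m \<and> (lex_less (i, j) (r, k) \<or> (i, j) = (r, k))) \<and>
     coeff2 p r k > 0 \<and>
     (\<integral>(x, y). (poly2 p x y)\<^sup>2 \<partial>M) = 1 \<and>
     (\<forall>i j. i < r \<and> j \<le> m \<or> i = r \<and> j < k \<longrightarrow> (\<integral>(x, y). poly2 p x y * (x ^ i * y ^ j) \<partial>M) = 0)"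

definition is_revlex_op ::
  "(real \<times> real) measure \<Rightarrow> nat \<Rightarrow> nat \<Rightarrow> nat \<Rightarrow> real poly poly \<Rightarrow> bool" where
  "is_revlex_op M n t l p \<longleftrightarrow>
     (\<forall>i j. coeff2 p i j \<noteq> 0 \<longrightarrow> i \<le> n \<and> (revlex_less (i, j) (l, t) \<or> (i, j) = (l, t))) \<and>
     coeff2 p l t > 0 \<and>
     (\<integral>(x, y). (poly2 p x y)\<^sup>2 \<partial>M) = 1 \<and>
     (\<forall>i j. j < t \<and> i \<le> n \<or> j = t \<and> i < l \<longrightarrow> (\<integral>(x, y). poly2 p x y * (x ^ i * y ^ j) \<partial>M) = 0)"

text \<open>\<open>op_lex N a m r k\<close> is \<open>p\<^sup>k\<^sub>r\<^sub>,\<^sub>m\<close> (for \<open>k \<le> m\<close>), and \<open>op_revlex N a n t l\<close> is the polynomial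
  \<open>p\<^sup>l\<^sub>n\<^sub>,\<^sub>t\<close> with tilde (for \<open>l \<le> n\<close>).\<close>

definition op_lex :: "nat \<Rightarrow> (nat \<Rightarrow> real) \<Rightarrow> nat \<Rightarrow> nat \<Rightarrow> nat \<Rightarrow> real poly poly" where
  "op_lex N a m r k = (THE p. is_lex_op (mu N a) m r k p)"

definition op_revlex :: "nat \<Rightarrow> (nat \<Rightarrow> real) \<Rightarrow> nat \<Rightarrow> nat \<Rightarrow> nat \<Rightarrow> real poly poly" where
  "op_revlex N a n t l = (THE p. is_revlex_op (mu N a) n t l p)"


section \<open>Well-definedness of the expansions and of the weight\<close>

lemma cpoly_add: "cpoly (p + p') x = cpoly p x + cpoly p' x"
proof -
  have "map_poly complex_of_real (p + p') = map_poly complex_of_real p + map_poly complex_of_real p'"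
    by (rule poly_eqI) (simp add: coeff_map_poly)
  thus ?thesis by simp
qed

lemma cpoly_smult: "cpoly (smult c p) x = of_real c * cpoly p x"
proof -
  have "map_poly complex_of_real (smult c p) = smult (of_real c) (map_poly complex_of_real p)"
    by (rule poly_eqI) (simp add: coeff_map_poly)
  thus ?thesis by simp
qed

lemma cpoly_pCons: "cpoly (pCons c p) x = of_real c + x * cpoly p x"
  by (simp add: map_poly_pCons)

lemma cpoly_of_real: "cpoly p (of_real x) = of_real (poly p x)"
  by (induction p) (simp_all add: cpoly_pCons del: map_poly_pCons)

lemma ex_joukowski: "\<exists>w. w \<noteq> 0 \<and> (w + 1/w) / 2 = (y :: complex)"
proof -
  define s where "s = csqrt (y\<^sup>2 - 1)"
  have s: "s * s = y * y - 1"
    using power2_csqrt[of "y\<^sup>2 - 1"] by (simp add: s_def power2_eq_square)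
  have e: "(y + s) * (y - s) = 1"
    using s by (simp add: algebra_simps)
  hence nz: "y + s \<noteq> 0"
    by auto
  hence "1 / (y + s) = y - s"
    using e by (simp add: field_simps)
  thus ?thesis
    using nz by (intro exI[of _ "y + s"]) simp
qed

lemma is_h_coeffs_unique:
  assumes "is_h_coeffs N a H" "is_h_coeffs N a G"
  shows "H = G"
proof (rule ext)
  fix i
  show "H i = G i"
  proof (cases "i \<le> 2 * N")
    case True
    have "poly (H i) y = poly (G i) y" for y
    proof -
      obtain w where w: "w \<noteq> 0" "(w + 1/w) / 2 = complex_of_real y"
        using ex_joukowski by blast
      have "(\<Sum>i\<le>2*N. cpoly (H i) (of_real y) * z ^ i) = (\<Sum>i\<le>2*N. cpoly (G i) (of_real y) * z ^ i)" for z
      proof -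
        have "K = H \<or> K = G \<Longrightarrow>
            omega N a z w * omega N a z (1/w) = (\<Sum>i\<le>2*N. cpoly (K i) (of_real y) * z ^ i)" for K
          using assms w(1) unfolding w(2)[symmetric] is_h_coeffs_def atLeast0AtMost by blast
        from this[of H] this[of G] show ?thesis by simp
      qed
      hence "cpoly (H i) (of_real y) = cpoly (G i) (of_real y)"
        using True polyfun_eq_coeffs[of "\<lambda>i. cpoly (H i) (of_real y)" "2*N"
            "\<lambda>i. cpoly (G i) (of_real y)"] by simp
      thus ?thesis
        by (simp add: cpoly_of_real)
    qed
    thus ?thesis
      by (simp add: poly_eq_poly_eq_iff[symmetric] fun_eq_iff)
  next
    case False
    thus ?thesis
      using assms by (simp add: is_h_coeffs_def)
  qed
qed

lemma is_h_coeffs_exists: "\<exists>H. is_h_coeffs N a H"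
proof (induction N)
  case 0
  have "is_h_coeffs 0 a (\<lambda>i. if i = 0 then 1 else 0)"
    by (simp add: is_h_coeffs_def omega_def)
  thus ?case by blast
next
  case (Suc N)
  then obtain H where H: "\<And>i. i > 2*N \<Longrightarrow> H i = 0" and
    E: "\<And>z w. w \<noteq> 0 \<Longrightarrow> omega N a z w * omega N a z (1/w) =
          (\<Sum>i\<le>2*N. cpoly (H i) ((w + 1/w) / 2) * z ^ i)"
    unfolding is_h_coeffs_def atLeast0AtMost by blast
  define c where "c = a (Suc N)"
  define G1 where "G1 = (\<lambda>i. case i of 0 \<Rightarrow> 0 | Suc j \<Rightarrow> smult (2 * c) (pCons 0 (H j)))"
  define G2 where "G2 = (\<lambda>i. case i of 0 \<Rightarrow> 0 | Suc 0 \<Rightarrow> 0 | Suc (Suc j) \<Rightarrow> smult (c\<^sup>2) (H j))"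
  define G where "G = (\<lambda>i. H i + G1 i + G2 i)"
  have "G i = 0" if "i > 2 * Suc N" for i
    using that by (auto simp: G_def G1_def G2_def H split: nat.splits)
  moreover have "omega (Suc N) a z w * omega (Suc N) a z (1/w) =
      (\<Sum>i\<le>2 * Suc N. cpoly (G i) ((w + 1/w) / 2) * z ^ i)" if w: "w \<noteq> 0" for z w
  proof -
    define y where "y = (w + 1/w) / 2"
    define S where "S = (\<Sum>i\<le>2*N. cpoly (H i) y * z ^ i)"
    have f: "(1 + of_real c * z * w) * (1 + of_real c * z * (1/w)) =
        1 + 2 * of_real c * y * z + of_real c ^ 2 * z ^ 2"
      using w by (simp add: y_def field_simps power2_eq_square)
    have "omega (Suc N) a z w * omega (Suc N) a z (1/w) =
        ((1 + of_real c * z * w) * (1 + of_real c * z * (1/w))) * (omega N a z w * omega N a z (1/w))"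
      by (simp add: omega_def c_def mult_ac)
    also have "\<dots> = (1 + 2 * of_real c * y * z + of_real c ^ 2 * z ^ 2) * S"
      unfolding f E[OF w] S_def y_def ..
    finally have 1: "omega (Suc N) a z w * omega (Suc N) a z (1/w) =
        (1 + 2 * of_real c * y * z + of_real c ^ 2 * z ^ 2) * S" .
    have s0: "(\<Sum>i\<le>2 * Suc N. cpoly (H i) y * z ^ i) = S"
      by (simp add: S_def H)
    have s1: "(\<Sum>i\<le>2 * Suc N. cpoly (G1 i) y * z ^ i) = 2 * of_real c * y * z * S"
    proof -
      have "(\<Sum>i\<le>2 * Suc N. cpoly (G1 i) y * z ^ i) =
          (\<Sum>i\<le>Suc (2*N). cpoly (G1 (Suc i)) y * z ^ Suc i)"
        using sum.atMost_Suc_shift[of "\<lambda>i. cpoly (G1 i) y * z ^ i" "Suc (2*N)"]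
        by (simp add: G1_def)
      also have "\<dots> = (\<Sum>i\<le>2*N. 2 * of_real c * y * z * (cpoly (H i) y * z ^ i))"
        by (simp add: G1_def cpoly_smult cpoly_pCons H mult_ac del: smult_pCons)
      finally show ?thesis
        by (simp add: S_def sum_distrib_left)
    qed
    have s2: "(\<Sum>i\<le>2 * Suc N. cpoly (G2 i) y * z ^ i) = of_real c ^ 2 * z ^ 2 * S"
    proof -
      have "(\<Sum>i\<le>2 * Suc N. cpoly (G2 i) y * z ^ i) =
          (\<Sum>i\<le>2*N. cpoly (G2 (Suc (Suc i))) y * z ^ Suc (Suc i))"
        using sum.atMost_Suc_shift[of "\<lambda>i. cpoly (G2 i) y * z ^ i" "Suc (2*N)"]
          sum.atMost_Suc_shift[of "\<lambda>i. cpoly (G2 (Suc i)) y * z ^ Suc i" "2*N"]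
        by (simp add: G2_def)
      also have "\<dots> = (\<Sum>i\<le>2*N. of_real c ^ 2 * z ^ 2 * (cpoly (H i) y * z ^ i))"
        by (simp add: G2_def cpoly_smult power2_eq_square mult_ac)
      finally show ?thesis
        by (simp add: S_def sum_distrib_left)
    qed
    have "(\<Sum>i\<le>2 * Suc N. cpoly (G i) y * z ^ i) =
        (\<Sum>i\<le>2 * Suc N. cpoly (H i) y * z ^ i) + (\<Sum>i\<le>2 * Suc N. cpoly (G1 i) y * z ^ i) +
        (\<Sum>i\<le>2 * Suc N. cpoly (G2 i) y * z ^ i)"
      unfolding G_def cpoly_add sum.distrib[symmetric] by (simp only: distrib_right)
    also have "\<dots> = (1 + 2 * of_real c * y * z + of_real c ^ 2 * z ^ 2) * S"
      unfolding s0 s1 s2 by (simp add: algebra_simps)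
    finally show ?thesis
      unfolding 1 y_def by simp
  qed
  ultimately have "is_h_coeffs (Suc N) a G"
    unfolding is_h_coeffs_def atLeast0AtMost by blast
  thus ?case by blast
qed

lemma omega_commute: "omega N a z w = omega N a w z"
  by (simp add: omega_def mult_ac)

lemma is_ht_coeffs_iff: "is_ht_coeffs N a H \<longleftrightarrow> is_h_coeffs N a H"
proof -
  have "omega N a z w * omega N a (1/z) w = omega N a w z * omega N a w (1/z)" for z w
    by (simp only: omega_commute[of N a w])
  thus ?thesis
    unfolding is_ht_coeffs_def is_h_coeffs_def by (simp only:) blast
qed

lemma ex1_h_coeffs: "\<exists>!H. is_h_coeffs N a H"
  using is_h_coeffs_exists is_h_coeffs_unique by blast

lemma ex1_ht_coeffs: "\<exists>!H. is_ht_coeffs N a H"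
  unfolding is_ht_coeffs_iff by (rule ex1_h_coeffs)

lemma h_eq_omega:
  assumes "w \<noteq> 0"
  shows "h N a z ((w + 1/w) / 2) = omega N a z w * omega N a z (1/w)"
proof -
  have "is_h_coeffs N a (h_coeff N a)"
    unfolding h_coeff_def by (rule theI'[OF ex1_h_coeffs])
  thus ?thesis
    using assms unfolding is_h_coeffs_def h_def by simp
qed

lemma ht_eq_omega:
  assumes "z \<noteq> 0"
  shows "ht N a ((z + 1/z) / 2) w = omega N a z w * omega N a (1/z) w"
proof -
  have "is_ht_coeffs N a (ht_coeff N a)"
    unfolding ht_coeff_def by (rule theI'[OF ex1_ht_coeffs])
  thus ?thesis
    using assms unfolding is_ht_coeffs_def ht_def by simp
qed

lemma cnj_omega: "cnj (omega N a z w) = omega N a (cnj z) (cnj w)"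
  by (simp add: omega_def)

lemma inverse_unit:
  assumes "cmod z = 1"
  shows "1 / z = cnj z"
proof -
  have "z * cnj z = 1"
    using assms by (simp add: complex_norm_square[symmetric])
  moreover have "z \<noteq> 0"
    using assms by auto
  ultimately show ?thesis
    by (simp add: divide_eq_eq mult.commute)
qed

lemma weight_eq:
  assumes "cmod z = 1" "cmod w = 1"
    and "of_real x = (z + 1/z) / 2" "of_real y = (w + 1/w) / 2"
  shows "weight N a x y = 4 / pi\<^sup>2 * (sqrt (1 - x\<^sup>2) * sqrt (1 - y\<^sup>2)) / (cmod (h N a z (of_real y)))\<^sup>2"
    and "weight N a x y = 4 / pi\<^sup>2 * (sqrt (1 - x\<^sup>2) * sqrt (1 - y\<^sup>2)) / (cmod (ht N a (of_real x) w))\<^sup>2"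
proof -
  have nz: "z \<noteq> 0" "w \<noteq> 0"
    using assms by auto
  have zw: "1/z = cnj z" "1/w = cnj w"
    using assms inverse_unit by auto
  have A: "cmod (omega N a (cnj z) (cnj w)) = cmod (omega N a z w)" for z w
    by (metis cnj_omega complex_mod_cnj)
  have H: "cmod (h N a z (of_real y)) = cmod (omega N a z w) * cmod (omega N a z (cnj w))" for z
    unfolding assms(4) h_eq_omega[OF nz(2)] zw(2)[symmetric] by (rule norm_mult)
  have Hc: "cmod (h N a (cnj z) (of_real y)) = cmod (h N a z (of_real y))" for z
    using A[of z w] A[of z "cnj w"] by (simp add: H)
  have x: "x = Re z"
    using arg_cong[OF assms(3), of Re] zw by simp
  have "\<bar>x\<bar> \<le> 1"
    using x assms(1) abs_Re_le_cmod[of z] by simp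
  have "(Re z)\<^sup>2 + (Im z)\<^sup>2 = 1"
    using assms(1) by (metis cmod_power2 one_power2)
  hence "\<bar>Im z\<bar> = sqrt (1 - x\<^sup>2)"
    unfolding x by (metis add_diff_cancel_left' real_sqrt_abs)
  hence "Im z = sin (arccos x) \<or> Im z = - sin (arccos x)"
    using \<open>\<bar>x\<bar> \<le> 1\<close> sin_arccos_abs[of x] by linarith
  moreover have "Re z = cos (arccos x)"
    using \<open>\<bar>x\<bar> \<le> 1\<close> x cos_arccos_abs[of x] by simp
  ultimately have "cis (arccos x) = z \<or> cis (arccos x) = cnj z"
    by (simp add: complex_eq_iff) linarith
  hence "cmod (h N a (cis (arccos x)) (of_real y)) = cmod (h N a z (of_real y))"
    using Hc by auto
  thus 1: "weight N a x y = 4 / pi\<^sup>2 * (sqrt (1 - x\<^sup>2) * sqrt (1 - y\<^sup>2)) / (cmod (h N a z (of_real y)))\<^sup>2"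
    by (simp add: weight_def)
  have "cmod (ht N a (of_real x) w) = cmod (omega N a z w) * cmod (omega N a (cnj z) w)"
    unfolding assms(3) ht_eq_omega[OF nz(1)] zw(1)[symmetric] by (rule norm_mult)
  also have "\<dots> = cmod (h N a z (of_real y))"
    using A[of z "cnj w"] by (simp add: H)
  finally show "weight N a x y = 4 / pi\<^sup>2 * (sqrt (1 - x\<^sup>2) * sqrt (1 - y\<^sup>2)) / (cmod (ht N a (of_real x) w))\<^sup>2"
    using 1 by simp
qed

end

(*
  Write omega(z,w) = sum_p e_p (zw)^p.  For fixed y the function q_r(.,y) is the Bernstein-Szego
  polynomial of sqrt(1-x^2)/|h(z,y)|^2: Cauchy's formula for z^p/h(z,y) makes it orthogonal to every
  polynomial in x of degree < r, whatever y is.  Likewise qt_t(x,.) is orthogonal to every polynomial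
  in y of degree < t.  Hence each combination
    sum_j  alpha_j q_{r+j} U_{k-j}(y) + beta_j qt_{m+1+j} U_{r+k-m-1-j}(x)
  has all the required orthogonality relations, and only its support has to be controlled.  With
  s = m - k the identity q_r U_k = sum e_p e_p' U_{r-p-p'}(x) U_{k+p-p'}(y) turns it into
    sum_p e_p sum_l f_l U_{r-p-l}(x) U_{k-p+l}(y),
  where the f_l are, up to a shift, the coefficients of A V + B V*, with V(u) = prod (1 + a_i u),
  V*(u) = prod (u + a_i) and deg A, deg B < N - s.  The support is right iff f_l = 0 unless
  0 <= l <= s: these are 2(N-s)-1 homogeneous equations for 2(N-s) unknowns.  A nontrivial solution
  gives a nonzero polynomial because V and V* are coprime, and its squared norm alpha_0 f_0 depends
  neither on r nor on m, so it can be normalised once for each s.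
*)
theory Submission
  imports Defs "HOL-Complex_Analysis.Cauchy_Integral_Formula"
    "HOL-Computational_Algebra.Polynomial_Factorial" "HOL-Computational_Algebra.Field_as_Ring"
begin

section \<open>Bernstein--Szego integrals in one variable\<close>

lemma sin_cheb_U_nat: "sin t * poly (cheb_U_nat n) (cos t) = sin (real (Suc n) * t)"
proof (induction n rule: cheb_U_nat.induct)
  case 2
  show ?case using sin_double[of t] by (simp add: mult_ac)
next
  case (3 n)
  define s where "s = real (Suc (Suc n)) * t"
  have "sin t * poly (cheb_U_nat (Suc (Suc n))) (cos t) = 2 * cos t * sin s - sin (s - t)"
    using 3 by (simp add: s_def algebra_simps)
  also have "\<dots> = sin (s + t)"
    by (simp add: sin_add sin_diff)
  finally show ?case
    by (simp add: s_def algebra_simps)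
qed simp

text \<open>The rule U_n = -U_{-n-2} mirrors the oddness of sine, so the trigonometric identity
  holds at every integer index and later index shifts need no case distinction.\<close>

lemma sin_cheb_U: "sin t * U n (cos t) = sin (of_int (n + 1) * t)"
proof -
  consider "n \<ge> 0" | "n = -1" | "n \<le> -2" by linarith
  thus ?thesis
  proof cases
    case 1
    thus ?thesis using sin_cheb_U_nat[of t "nat n"] by (simp add: cheb_U_def add.commute)
  next
    case 3
    have "of_int (n + 1) * t = - (real (Suc (nat (- n - 2))) * t)"
      using 3 by (simp add: algebra_simps)
    thus ?thesis using 3 sin_cheb_U_nat[of t "nat (- n - 2)"] by (simp add: cheb_U_def)
  qed (simp add: cheb_U_def)
qed

section \<open>Degrees and leading coefficients of Chebyshev polynomials\<close>

lemma coeff_cheb_U_nat_gt: "i > n \<Longrightarrow> coeff (cheb_U_nat n) i = 0"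
  by (induction n arbitrary: i rule: cheb_U_nat.induct)
     (auto simp: coeff_pCons split: nat.splits)

lemma coeff_cheb_U_nat_top: "coeff (cheb_U_nat n) n = 2 ^ n"
  by (induction n rule: cheb_U_nat.induct) (auto simp: coeff_pCons coeff_cheb_U_nat_gt)

text \<open>The second argument of \<open>max\<close> is the degree -n-2 that the reflection rule
  gives at indices below -1.\<close>

lemma coeff_cheb_U_gt: "int i > max n (- n - 2) \<Longrightarrow> coeff (cheb_U n) i = 0"
  by (auto simp: cheb_U_def coeff_cheb_U_nat_gt)

lemma coeff_cheb_U_top: "coeff (cheb_U (int n)) n = 2 ^ n"
  by (simp add: cheb_U_def coeff_cheb_U_nat_top)

section \<open>Means over the unit circle and the substitution x = cos t\<close>

lemma has_integral_circle_mean: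
  assumes "continuous_on (cball 0 1) f" "f holomorphic_on ball 0 1"
  shows "((\<lambda>t. f (cis t)) has_integral (2 * of_real pi * f 0)) {0..2*pi}"
proof -
  have "((\<lambda>u. f u / (u - 0)) has_contour_integral (2 * of_real pi * \<i> * f 0)) (circlepath 0 1)"
    using assms by (intro Cauchy_integral_circlepath) auto
  \<comment> \<open>In the parametrisation by \<open>cis\<close> the derivative i z cancels the
    kernel 1/z, up to the factor i removed next.\<close>
  hence "((\<lambda>t. f (cis t) / cis t * \<i> * cis t) has_integral (2 * of_real pi * \<i> * f 0)) {0..2*pi}"
    unfolding circlepath_def by (subst (asm) has_contour_integral_part_circlepath_iff) auto
  hence "((\<lambda>t. - \<i> * (f (cis t) / cis t * \<i> * cis t)) has_integral (- \<i> * (2 * of_real pi * \<i> * f 0))) {0..2*pi}"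
    by (rule has_integral_mult_right)
  thus ?thesis by (simp add: field_simps)
qed

lemma integral_substitute_cos:
  fixes f :: "real \<Rightarrow> real"
  assumes "continuous_on {-1..1} f"
  shows "integral {-1..1} f = integral {0..pi} (\<lambda>t. sin t * f (cos t))"
proof -
  have "((\<lambda>t. (- sin t) *\<^sub>R f (cos t)) has_integral
      (integral {cos 0..cos pi} f - integral {cos pi..cos 0} f)) {0..pi}"
    using assms
    by (intro has_integral_substitution_general[where s = "{}" and c = "-1" and d = 1])
       (auto intro!: continuous_intros derivative_eq_intros)
  \<comment> \<open>Cosine decreases on [0, pi], so the first of the two integrals runs over an
    empty interval and the sign flips.\<close>
  hence "((\<lambda>t. - (sin t * f (cos t))) has_integral (- integral {-1..1} f)) {0..pi}"
    by simp
  from has_integral_neg[OF this]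
  have "((\<lambda>t. sin t * f (cos t)) has_integral integral {-1..1} f) {0..pi}"
    by simp
  thus ?thesis by (simp add: integral_unique)
qed

text \<open>The reflection of t to 2 pi - t carries one half of the period onto the other, so both
  halves contribute equally.\<close>

lemma has_integral_half_period:
  fixes f :: "real \<Rightarrow> real"
  assumes c: "continuous_on {0..2*pi} f" and s: "\<And>t. f (2*pi - t) = f t"
    and I: "(f has_integral I) {0..2*pi}"
  shows "(f has_integral (I / 2)) {0..pi}"
proof -
  have i: "f integrable_on {0..pi}" "f integrable_on {pi..2*pi}"
    by (rule integrable_continuous_interval, rule continuous_on_subset[OF c], simp)+
  have "((\<lambda>t. (-1) *\<^sub>R f (2*pi - t)) has_integral
      (integral {2*pi - 0..2*pi - pi} f - integral {2*pi - pi..2*pi - 0} f)) {0..pi}"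
    using c
    by (intro has_integral_substitution_general[where s = "{}" and c = 0 and d = "2*pi"])
       (auto intro!: continuous_intros derivative_eq_intros)
  hence "((\<lambda>t. - f t) has_integral (- integral {pi..2*pi} f)) {0..pi}"
    by (simp add: s)
  from has_integral_neg[OF this] have "(f has_integral integral {pi..2*pi} f) {0..pi}"
    by simp
  hence e: "integral {0..pi} f = integral {pi..2*pi} f"
    by (rule integral_unique)
  have "I = integral {0..2*pi} f" using I by (simp add: integral_unique)
  also have "\<dots> = integral {0..pi} f + integral {pi..2*pi} f"
    using integrable_continuous_interval[OF c]
    by (intro Henstock_Kurzweil_Integration.integral_combine[symmetric]) auto
  finally have "I / 2 = integral {0..pi} f" using e by simp
  thus ?thesis using i(1) by (simp add: has_integral_integral)
qed

section \<open>One-variable orthogonality for a denominator without zeros in the closed unit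
  disc\<close>

context
  fixes c :: "nat \<Rightarrow> real" and D :: nat and g :: "complex \<Rightarrow> complex"
  defines "g \<equiv> \<lambda>z. \<Sum>i\<le>D. of_real (c i) * z ^ i"
  assumes c0: "c 0 = 1" and nz: "\<And>z. cmod z \<le> 1 \<Longrightarrow> g z \<noteq> 0"
begin

lemma continuous_on_denominator: "continuous_on A f \<Longrightarrow> continuous_on A (\<lambda>x. g (f x))"
  unfolding g_def by (intro continuous_intros)

text \<open>With z = \<open>cis t\<close>, writing the sine in exponentials leaves z^(r+n+2)/g and
  z^(r-n)/g. Both are analytic in the disc because n <= r, so their means are their values at 0;
  only the power z^0, which occurs for n = r, has a nonzero one.\<close>

lemma has_integral_Im_divide_sin:
  assumes "n \<le> r"
  shows "((\<lambda>t. Im (cis t ^ Suc r / g (cis t)) * sin (real (Suc n) * t)) has_integral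
            (if n = r then pi / 2 else 0)) {0..pi}"
proof -
  let ?K = "\<lambda>t. Im (cis t ^ Suc r / g (cis t)) * sin (real (Suc n) * t)"
  have g0: "g 0 = 1"
    using c0 by (simp add: g_def power_0_left if_distrib cong: if_cong)
  have C: "((\<lambda>t. cis t ^ p / g (cis t)) has_integral (if p = 0 then 2 * pi else 0)) {0..2*pi}" for p
  proof -
    have "((\<lambda>t. cis t ^ p / g (cis t)) has_integral (2 * of_real pi * (0 ^ p / g 0))) {0..2*pi}"
    proof (rule has_integral_circle_mean)
      show "continuous_on (cball 0 1) (\<lambda>z. z ^ p / g z)"
        using nz by (intro continuous_intros continuous_on_denominator) auto
      show "(\<lambda>z. z ^ p / g z) holomorphic_on ball 0 1"
        using nz unfolding g_def by (intro holomorphic_intros) auto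
    qed
    thus ?thesis using g0 by (simp add: power_0_left split: if_splits)
  qed
  have S: "(cis t ^ (r + n + 2) / g (cis t) - cis t ^ (r - n) / g (cis t)) / (2 * \<i>) =
      cis t ^ Suc r / g (cis t) * of_real (sin (real (Suc n) * t))" for t
  proof -
    have 1: "of_real (sin (real (Suc n) * t)) = (cis (real (Suc n) * t) - cis (- (real (Suc n) * t))) / (2 * \<i>)"
      by (simp add: complex_eq_iff)
    have "cis t ^ Suc r * cis (real (Suc n) * t) = cis t ^ (r + n + 2)"
      by (simp only: Complex.DeMoivre cis_mult) (simp add: algebra_simps)
    moreover have "cis t ^ Suc r * cis (- (real (Suc n) * t)) = cis t ^ (r - n)"
      using assms by (simp only: Complex.DeMoivre cis_mult) (simp add: algebra_simps of_nat_diff)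
    moreover have "X / G * ((P - Q) / (2 * \<i>)) = (X * P / G - X * Q / G) / (2 * \<i>)" for X G P Q :: complex
      by (simp add: diff_divide_distrib right_diff_distrib mult_ac)
    ultimately show ?thesis
      unfolding 1 by metis
  qed
  have ImX: "Im (X * of_real s) = Im X * s" for X s by simp
  from has_integral_linear[OF has_integral_divide[OF has_integral_diff[OF C[of "r + n + 2"] C[of "r - n"]],
      of "2 * \<i>"] bounded_linear_Im]
  have "(?K has_integral Im ((of_real (if r + n + 2 = 0 then 2 * pi else 0) -
      of_real (if r - n = 0 then 2 * pi else 0)) / (2 * \<i>))) {0..2*pi}"
    unfolding o_def S ImX by simp
  hence K: "(?K has_integral (if n = r then pi else 0)) {0..2*pi}"
    using assms by (cases "n = r") (simp_all add: Im_divide del: power_Suc)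
  \<comment> \<open>The coefficients of \<open>g\<close> are real, so t to 2 pi - t conjugates the
    quotient and changes the sign of both factors of the integrand.\<close>
  have "(?K has_integral (if n = r then pi else 0) / 2) {0..pi}"
  proof (rule has_integral_half_period[OF _ _ K])
    show "continuous_on {0..2*pi} ?K"
      using nz by (intro continuous_intros continuous_on_denominator) auto
    fix t :: real
    have 1: "cis (2*pi - t) = cnj (cis t)"
      by (simp add: complex_eq_iff)
    have 2: "g (cnj z) = cnj (g z)" for z by (simp add: g_def)
    have "sin (real (Suc n) * (2*pi - t)) = sin (2 * real (Suc n) * pi - real (Suc n) * t)"
      by (simp add: algebra_simps)
    also have "\<dots> = - sin (real (Suc n) * t)"
      unfolding sin_diff sin_2npi cos_2npi by simp
    finally have 3: "sin (real (Suc n) * (2*pi - t)) = - sin (real (Suc n) * t)" .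
    have "cis (2*pi - t) ^ Suc r / g (cis (2*pi - t)) = cnj (cis t ^ Suc r / g (cis t))"
      by (simp only: 1 2 complex_cnj_power complex_cnj_divide)
    moreover have "Im (cnj X) * - s = Im X * s" for X s by simp
    ultimately show "?K (2*pi - t) = ?K t" by (simp only: 3)
  qed
  thus ?thesis by (simp split: if_splits)
qed

lemma continuous_on_bernstein_szego:
  fixes F :: "real \<Rightarrow> real"
  assumes "continuous_on {-1..1} F"
  shows "continuous_on {-1..1} (\<lambda>x. F x * sqrt (1 - x\<^sup>2) / (cmod (g (cis (arccos x))))\<^sup>2)"
  using assms nz
  by (intro continuous_intros continuous_on_denominator continuous_on_arccos) auto

text \<open>At x = cos t the factor sin t turns the Chebyshev sum into the imaginary part of z^(r+1)
  times the conjugate of g(z). Division by |g|^2 then leaves Im(z^(r+1)/g), the integrand of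
  \<open>has_integral_Im_divide_sin\<close>.\<close>

lemma integral_bernstein_szego_cheb:
  assumes "n \<le> r"
  shows "integral {-1..1} (\<lambda>x. (\<Sum>i\<le>D. c i * U (int r - int i) x) * U (int n) x * sqrt (1 - x\<^sup>2)
            / (cmod (g (cis (arccos x))))\<^sup>2) = (if n = r then pi / 2 else 0)"
proof -
  let ?Q = "\<lambda>x. \<Sum>i\<le>D. c i * U (int r - int i) x"
  have "integral {-1..1} (\<lambda>x. ?Q x * U (int n) x * sqrt (1 - x\<^sup>2) / (cmod (g (cis (arccos x))))\<^sup>2) =
      integral {0..pi} (\<lambda>t. sin t * (?Q (cos t) * U (int n) (cos t) * sqrt (1 - (cos t)\<^sup>2)
        / (cmod (g (cis (arccos (cos t)))))\<^sup>2))"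
    by (intro integral_substitute_cos continuous_on_bernstein_szego) (intro continuous_intros)
  also have "\<dots> = integral {0..pi} (\<lambda>t. Im (cis t ^ Suc r / g (cis t)) * sin (real (Suc n) * t))"
  proof (rule integral_cong)
    fix t :: real assume t: "t \<in> {0..pi}"
    have s: "sqrt (1 - (cos t)\<^sup>2) = sin t"
      using t sin_ge_zero[of t] by (simp add: sin_squared_eq[symmetric])
    have a: "arccos (cos t) = t" using t by (simp add: arccos_cos)
    have Q: "sin t * ?Q (cos t) = Im (cis t ^ Suc r * cnj (g (cis t)))"
    proof -
      have "cis t ^ Suc r * cnj (g (cis t)) = (\<Sum>i\<le>D. of_real (c i) * cis (of_int (int r - int i + 1) * t))"
        unfolding g_def cnj_sum sum_distrib_left
      proof (intro sum.cong refl)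
        fix i
        have "cis t ^ Suc r * cnj (cis t ^ i) = cis (of_int (int r - int i + 1) * t)"
          by (simp only: Complex.DeMoivre cis_cnj cis_mult) (simp add: algebra_simps)
        thus "cis t ^ Suc r * cnj (of_real (c i) * cis t ^ i) =
            of_real (c i) * cis (of_int (int r - int i + 1) * t)"
          by (simp add: mult_ac)
      qed
      also have "Im \<dots> = (\<Sum>i\<le>D. c i * (sin t * U (int r - int i) (cos t)))"
        by (simp add: sin_cheb_U)
      finally show ?thesis by (simp add: sum_distrib_left mult_ac)
    qed
    have "g (cis t) \<noteq> 0" using nz by simp
    hence G: "Im (cis t ^ Suc r / g (cis t)) = sin t * ?Q (cos t) / (cmod (g (cis t)))\<^sup>2"
      unfolding Q by (simp add: complex_div_cnj[of _ "g (cis t)"] Im_divide_of_real del: power_Suc flip: of_real_power)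
    have n: "sin (real (Suc n) * t) = sin t * U (int n) (cos t)"
      unfolding sin_cheb_U by (simp add: add.commute)
    show "sin t * (?Q (cos t) * U (int n) (cos t) * sqrt (1 - (cos t)\<^sup>2)
        / (cmod (g (cis (arccos (cos t)))))\<^sup>2) =
        Im (cis t ^ Suc r / g (cis t)) * sin (real (Suc n) * t)"
      unfolding s a G n by simp
  qed
  also have "\<dots> = (if n = r then pi / 2 else 0)"
    by (rule integral_unique[OF has_integral_Im_divide_sin[OF assms]])
  finally show ?thesis .
qed

text \<open>Linearity extends the Chebyshev case: leading terms are peeled off as multiples of U_n,
  whose leading coefficient 2^n accounts for the division by 2^r.\<close>

lemma integral_bernstein_szego:
  assumes "degree P \<le> r"
  shows "integral {-1..1} (\<lambda>x. (\<Sum>i\<le>D. c i * U (int r - int i) x) * poly P x * sqrt (1 - x\<^sup>2)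
            / (cmod (g (cis (arccos x))))\<^sup>2) = pi / 2 * (coeff P r / 2 ^ r)"
proof -
  define L where "L = (\<lambda>P. integral {-1..1} (\<lambda>x. (\<Sum>i\<le>D. c i * U (int r - int i) x) * poly P x
    * sqrt (1 - x\<^sup>2) / (cmod (g (cis (arccos x))))\<^sup>2))"
  have i: "(\<lambda>x. (\<Sum>i\<le>D. c i * U (int r - int i) x) * poly P x
    * sqrt (1 - x\<^sup>2) / (cmod (g (cis (arccos x))))\<^sup>2) integrable_on {-1..1}" for P
    by (intro integrable_continuous_interval continuous_on_bernstein_szego continuous_intros)
  have add: "L (P + Q) = L P + L Q" for P Q
    unfolding L_def by (subst integral_add[OF i i, symmetric]) (simp add: algebra_simps add_divide_distrib)
  have smult: "L (smult a P) = a * L P" for a P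
    unfolding L_def by (subst integral_mult_right[symmetric]) (simp add: mult_ac)
  have "L P = pi / 2 * (coeff P r / 2 ^ r)" if "degree P \<le> n" "n \<le> r" for P n
    using that
  proof (induction n arbitrary: P)
    case 0
    then obtain a where P: "P = [:a:]" by (auto elim: degree_eq_zeroE)
    have P': "P = smult a (cheb_U (int 0))" by (simp add: P cheb_U_def)
    have "L (cheb_U (int 0)) = (if 0 = r then pi / 2 else 0)"
      unfolding L_def by (intro integral_bernstein_szego_cheb) simp
    moreover have "L P = a * L (cheb_U (int 0))"
      unfolding P' smult ..
    ultimately show ?case by (simp add: P coeff_pCons split: nat.splits)
  next
    case (Suc n)
    define b where "b = coeff P (Suc n) / 2 ^ Suc n"
    define R where "R = P - smult b (cheb_U (int (Suc n)))"
    have "coeff R i = 0" if "i > n" for i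
    proof (cases "i = Suc n")
      case True
      show ?thesis unfolding True R_def b_def coeff_diff coeff_smult coeff_cheb_U_top by simp
    next
      case False
      hence "coeff P i = 0" "coeff (cheb_U (int (Suc n))) i = 0"
        using Suc.prems(1) that by (auto intro: coeff_eq_0 coeff_cheb_U_gt)
      thus ?thesis by (simp add: R_def)
    qed
    hence "degree R \<le> n" by (intro degree_le) auto
    hence R: "L R = pi / 2 * (coeff R r / 2 ^ r)" using Suc by auto
    have "L (cheb_U (int (Suc n))) = (if Suc n = r then pi / 2 else 0)"
      unfolding L_def by (intro integral_bernstein_szego_cheb Suc.prems)
    also have "\<dots> = pi / 2 * (coeff (cheb_U (int (Suc n))) r / 2 ^ r)"
      using Suc.prems(2) coeff_cheb_U_top[of "Suc n"] coeff_cheb_U_gt[of "int (Suc n)" r] by auto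
    finally have T: "L (cheb_U (int (Suc n))) = pi / 2 * (coeff (cheb_U (int (Suc n))) r / 2 ^ r)" .
    have P: "P = R + smult b (cheb_U (int (Suc n)))" by (simp add: R_def)
    have "L P = L R + b * L (cheb_U (int (Suc n)))" by (subst P) (simp only: add smult)
    also have "\<dots> = pi / 2 * (coeff P r / 2 ^ r)"
      unfolding R T by (subst P) (simp add: algebra_simps add_divide_distrib)
    finally show ?case .
  qed
  thus ?thesis using assms unfolding L_def by blast
qed

end

text \<open>Denominator 1 gives the classical orthogonality; with the factor 2/pi the U_k have norm
  1.\<close>

lemma integral_cheb_U:
  assumes "degree P \<le> k"
  shows "2 / pi * integral {-1..1} (\<lambda>y. U (int k) y * poly P y * sqrt (1 - y\<^sup>2)) = coeff P k / 2 ^ k"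
proof -
  have "integral {-1..1} (\<lambda>x. (\<Sum>i\<le>0. (\<lambda>_. 1) i * U (int k - int i) x) * poly P x * sqrt (1 - x\<^sup>2)
     / (cmod ((\<lambda>z. \<Sum>i\<le>0. of_real ((\<lambda>_. 1) i) * z ^ i) (cis (arccos x))))\<^sup>2) = pi / 2 * (coeff P k / 2 ^ k)"
    by (intro integral_bernstein_szego assms) auto
  thus ?thesis by simp
qed

section \<open>Integration against \<open>mu\<close>\<close>

lemma ht_coeff_eq: "ht_coeff N a = h_coeff N a"
  by (simp add: ht_coeff_def h_coeff_def is_ht_coeffs_iff)

text \<open>Reduces every statement about \<open>qt\<close> to one about \<open>q\<close>, and
  finally the second half of the theorem to the first.\<close>

lemma qt_eq_q: "qt N a t x y = q N a t y x"
  by (simp add: qt_def q_def ht_coeff_eq)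

lemma cis_arccos_joukowski:
  assumes "x \<in> {-1..1}"
  shows "of_real x = (cis (arccos x) + 1 / cis (arccos x)) / 2"
proof -
  have "1 / cis (arccos x) = cnj (cis (arccos x))" by (rule inverse_unit) simp
  thus ?thesis using assms by (simp add: complex_eq_iff)
qed

text \<open>Compares the two expressions in \<open>weight_eq\<close>: \<open>ht\<close> is
  \<open>h\<close> with the variables renamed.\<close>

lemma weight_commute:
  assumes "x \<in> {-1..1}" "y \<in> {-1..1}"
  shows "weight N a x y = weight N a y x"
proof -
  have "ht N a (of_real x) w = h N a w (of_real x)" for w
    by (simp add: ht_def h_def ht_coeff_eq)
  hence "weight N a x y = 4 / pi\<^sup>2 * (sqrt (1 - x\<^sup>2) * sqrt (1 - y\<^sup>2)) /
      (cmod (h N a (cis (arccos y)) (of_real x)))\<^sup>2"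
    by (subst weight_eq(2)[OF _ _ cis_arccos_joukowski[OF assms(1)] cis_arccos_joukowski[OF assms(2)]])
       simp_all
  thus ?thesis by (simp add: weight_def mult.commute)
qed

lemma h_of_real: "h N a z (of_real y) = (\<Sum>i\<le>2*N. of_real (poly (h_coeff N a i) y) * z ^ i)"
  by (simp add: h_def cpoly_of_real atLeast0AtMost)

text \<open>Supplies the condition \<open>c 0 = 1\<close> of the one-variable results: at z = 0 both
  factors \<open>omega\<close> equal 1.\<close>

lemma poly_h_coeff_0:
  assumes "y \<in> {-1..1}"
  shows "poly (h_coeff N a 0) y = 1"
proof -
  have "h N a 0 (of_real y) = of_real (poly (h_coeff N a 0) y)"
    unfolding h_of_real by (simp add: power_0_left if_distrib cong: if_cong)
  moreover have "h N a 0 (of_real y) = 1"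
    by (subst cis_arccos_joukowski[OF assms], subst h_eq_omega) (simp_all add: omega_def)
  ultimately show ?thesis by simp
qed

section \<open>Continuity and positivity of the weight, integration over the square\<close>

locale bernstein_szego_weight =
  fixes N :: nat and a :: "nat \<Rightarrow> real"
  assumes a_less: "\<And>i. i \<in> {1..N} \<Longrightarrow> \<bar>a i\<bar> < 1"
begin

lemma omega_nonzero:
  assumes "cmod z \<le> 1" "cmod w \<le> 1"
  shows "omega N a z w \<noteq> 0"
proof -
  have "1 + of_real (a i) * z * w \<noteq> 0" if "i \<in> {1..N}" for i
  proof
    assume "1 + of_real (a i) * z * w = 0"
    hence "of_real (a i) * (z * w) = - 1" by (simp only: eq_neg_iff_add_eq_0 ac_simps)
    hence "cmod (of_real (a i) * (z * w)) = 1" by simp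
    moreover have "cmod (of_real (a i) * (z * w)) \<le> \<bar>a i\<bar> * (1 * 1)"
      unfolding norm_mult norm_of_real using assms by (intro mult_mono) auto
    ultimately show False using a_less[OF that] by simp
  qed
  thus ?thesis by (simp add: omega_def)
qed

lemma h_nonzero:
  assumes "cmod z \<le> 1" "y \<in> {-1..1}"
  shows "h N a z (of_real y) \<noteq> 0"
  using assms(1)
  by (subst cis_arccos_joukowski[OF assms(2)], subst h_eq_omega)
     (simp_all add: omega_nonzero norm_divide)

lemma continuous_on_weight:
  "continuous_on (cbox (-1, -1) (1, 1)) (\<lambda>(x, y). weight N a x y)"
proof -
  have "continuous_on (cbox (-1, -1) (1, 1))
     (\<lambda>z. 4 / pi\<^sup>2 * (sqrt (1 - (fst z)\<^sup>2) * sqrt (1 - (snd z)\<^sup>2))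
        / (cmod (h N a (cis (arccos (fst z))) (of_real (snd z))))\<^sup>2)"
  proof (intro continuous_intros ballI)
    show "continuous_on (cbox (-1, -1) (1, 1)) (\<lambda>z. h N a (cis (arccos (fst z))) (of_real (snd z)))"
      unfolding h_of_real
      by (intro continuous_intros continuous_on_arccos) auto
  qed (use h_nonzero in auto)
  thus ?thesis by (simp add: weight_def case_prod_unfold)
qed

lemma weight_nonneg: "x \<in> {-1..1} \<Longrightarrow> y \<in> {-1..1} \<Longrightarrow> weight N a x y \<ge> 0"
  unfolding weight_def by (intro divide_nonneg_nonneg mult_nonneg_nonneg) (auto simp: abs_square_le_1)

lemma weight_pos:
  assumes "x \<in> {-1<..<1}" "y \<in> {-1<..<1}"
  shows "weight N a x y > 0"
proof -
  have "h N a (cis (arccos x)) (of_real y) \<noteq> 0"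
    using assms by (intro h_nonzero) auto
  moreover have "x\<^sup>2 < 1" "y\<^sup>2 < 1"
    using assms by (auto simp: abs_square_less_1)
  ultimately show ?thesis by (simp add: weight_def)
qed

text \<open>The weight is continuous on the compact square, so integrals against \<open>mu\<close>
  exist and become gauge integrals, the form in which the one-variable results are stated.\<close>

lemma
  fixes f :: "real \<times> real \<Rightarrow> real"
  assumes "continuous_on UNIV f"
  shows integrable_mu: "integrable (mu N a) f"
    and integral_mu: "(\<integral>z. f z \<partial>mu N a) =
      integral (cbox (-1, -1) (1, 1)) (\<lambda>z. f z * (case z of (x, y) \<Rightarrow> weight N a x y))"
proof -
  let ?S = "cbox (-1, -1) (1, 1) :: (real \<times> real) set"
  let ?w = "\<lambda>(x, y). weight N a x y"
  let ?g = "\<lambda>z. indicator ?S z *\<^sub>R ?w z"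
  have S: "{-1..1} \<times> {-1..1} = ?S" by auto
  have mu: "mu N a = density lborel (\<lambda>z. ennreal (?g z))"
    unfolding mu_def S by (simp add: case_prod_unfold)
  have g: "?g \<in> borel_measurable lborel"
    using borel_measurable_continuous_on_indicator[OF _ continuous_on_weight] by simp
  have f: "f \<in> borel_measurable lborel"
    using borel_measurable_continuous_onI[OF assms] by simp
  have g0: "AE z in lborel. 0 \<le> ?g z"
    by (intro AE_I2) (auto simp: indicator_def weight_nonneg)
  have e: "?g z *\<^sub>R f z = indicator ?S z *\<^sub>R (f z * ?w z)" for z by simp
  have c: "continuous_on ?S (\<lambda>z. f z * ?w z)"
    by (intro continuous_on_mult continuous_on_weight continuous_on_subset[OF assms]) auto
  have si: "set_integrable lborel ?S (\<lambda>z. f z * ?w z)"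
    unfolding set_integrable_def by (intro borel_integrable_compact c compact_cbox)
  show "integrable (mu N a) f"
    unfolding mu integrable_density[OF f g g0] e using si by (simp add: set_integrable_def)
  show "(\<integral>z. f z \<partial>mu N a) = integral ?S (\<lambda>z. f z * ?w z)"
    unfolding mu integral_density[OF f g g0] e
    using set_borel_integral_eq_integral(2)[OF si] by (simp add: set_lebesgue_integral_def)
qed

lemma integral_mu_iterated:
  assumes "continuous_on UNIV (\<lambda>(x, y). f x y)"
  shows "(\<integral>(x, y). f x y \<partial>mu N a) =
      integral {-1..1} (\<lambda>y. integral {-1..1} (\<lambda>x. f x y * weight N a x y))"
    and "(\<integral>(x, y). f x y \<partial>mu N a) =
      integral {-1..1} (\<lambda>x. integral {-1..1} (\<lambda>y. f x y * weight N a x y))"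
proof -
  have c: "continuous_on (cbox (-1, -1) (1, 1)) (\<lambda>(x, y). f x y * weight N a x y)"
    using continuous_on_mult[OF continuous_on_subset[OF assms] continuous_on_weight]
    by (simp add: case_prod_unfold)
  show 1: "(\<integral>(x, y). f x y \<partial>mu N a) =
      integral {-1..1} (\<lambda>x. integral {-1..1} (\<lambda>y. f x y * weight N a x y))"
    using integral_mu[OF assms] integral_prod_continuous[OF c]
    by (simp add: case_prod_unfold)
  show "(\<integral>(x, y). f x y \<partial>mu N a) =
      integral {-1..1} (\<lambda>y. integral {-1..1} (\<lambda>x. f x y * weight N a x y))"
    unfolding 1 using integral_swap_continuous[OF c] by simp
qed

lemma integral_mu_swap:
  fixes f :: "real \<Rightarrow> real \<Rightarrow> real"
  assumes "continuous_on UNIV (\<lambda>(x, y). f x y)"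
  shows "(\<integral>(x, y). f y x \<partial>mu N a) = (\<integral>(x, y). f x y \<partial>mu N a)"
proof -
  have "continuous_on UNIV ((\<lambda>(x, y). f x y) \<circ> prod.swap)"
    by (intro continuous_on_compose continuous_on_swap continuous_on_subset[OF assms]) auto
  hence c: "continuous_on UNIV (\<lambda>(x, y). f y x)" by (simp add: case_prod_unfold o_def)
  show ?thesis
    unfolding integral_mu_iterated(1)[OF c] integral_mu_iterated(2)[OF assms]
    by (intro integral_cong) (simp add: weight_commute)
qed

text \<open>For each y the polynomial h(.,y) is an admissible denominator, and the inner integral in
  x depends on \<open>P\<close> through one coefficient only. All dependence on \<open>h\<close>
  disappears, leaving the Chebyshev weight in y with the constant 4/pi^2 times pi/2.\<close>

lemma integral_mu_q:
  assumes "degree P \<le> r"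
  shows "(\<integral>(x, y). q N a r x y * poly P x * poly G y \<partial>mu N a) =
      coeff P r / 2 ^ r * (2 / pi * integral {-1..1} (\<lambda>y. poly G y * sqrt (1 - y\<^sup>2)))"
proof -
  have "continuous_on UNIV (\<lambda>(x, y). q N a r x y * poly P x * poly G y)"
    unfolding q_def case_prod_unfold by (intro continuous_intros)
  hence "(\<integral>(x, y). q N a r x y * poly P x * poly G y \<partial>mu N a) =
      integral {-1..1} (\<lambda>y. integral {-1..1} (\<lambda>x. q N a r x y * poly P x * poly G y * weight N a x y))"
    by (rule integral_mu_iterated)
  also have "\<dots> = integral {-1..1} (\<lambda>y. (coeff P r / 2 ^ r * (2 / pi)) * (poly G y * sqrt (1 - y\<^sup>2)))"
  proof (rule integral_cong)
    fix y :: real assume y: "y \<in> {-1..1}"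
    have "integral {-1..1} (\<lambda>x. (\<Sum>i\<le>2*N. poly (h_coeff N a i) y * U (int r - int i) x) * poly P x * sqrt (1 - x\<^sup>2)
      / (cmod (\<Sum>i\<le>2*N. of_real (poly (h_coeff N a i) y) * cis (arccos x) ^ i))\<^sup>2) = pi / 2 * (coeff P r / 2 ^ r)"
      using h_nonzero[OF _ y] poly_h_coeff_0[OF y] unfolding h_of_real
      by (intro integral_bernstein_szego assms) auto
    hence *: "integral {-1..1} (\<lambda>x. q N a r x y * poly P x * sqrt (1 - x\<^sup>2)
      / (cmod (h N a (cis (arccos x)) (of_real y)))\<^sup>2) = pi / 2 * (coeff P r / 2 ^ r)"
      unfolding h_of_real q_def atLeast0AtMost .
    have "integral {-1..1} (\<lambda>x. q N a r x y * poly P x * poly G y * weight N a x y) =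
       integral {-1..1} (\<lambda>x. 4 / pi\<^sup>2 * sqrt (1 - y\<^sup>2) * poly G y * (q N a r x y * poly P x * sqrt (1 - x\<^sup>2)
      / (cmod (h N a (cis (arccos x)) (of_real y)))\<^sup>2))"
      by (simp add: weight_def mult_ac)
    also have "\<dots> = 4 / pi\<^sup>2 * sqrt (1 - y\<^sup>2) * poly G y * (pi / 2 * (coeff P r / 2 ^ r))"
      by (simp only: integral_mult_right *)
    finally show "integral {-1..1} (\<lambda>x. q N a r x y * poly P x * poly G y * weight N a x y) =
       (coeff P r / 2 ^ r * (2 / pi)) * (poly G y * sqrt (1 - y\<^sup>2))"
      by (simp add: power2_eq_square field_simps)
  qed
  also have "\<dots> = coeff P r / 2 ^ r * (2 / pi * integral {-1..1} (\<lambda>y. poly G y * sqrt (1 - y\<^sup>2)))"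
    by (simp only: integral_mult_right mult.assoc)
  finally show ?thesis .
qed

end

section \<open>Uniqueness of the orthonormal polynomials\<close>

lemma poly2_pCons: "poly2 (pCons c p) x y = poly c y + x * poly2 p x y"
  by (simp add: poly2_def)

lemma poly2_0 [simp]: "poly2 0 x y = 0"
  by (simp add: poly2_def)

lemma poly2_diff: "poly2 (p - p') x y = poly2 p x y - poly2 p' x y"
  by (simp add: poly2_def)

lemma poly2_sum: "poly2 (sum f A) x y = (\<Sum>i\<in>A. poly2 (f i) x y)"
  by (simp add: poly2_def poly_sum)

lemma coeff2_sum: "coeff2 (sum f A) i j = (\<Sum>k\<in>A. coeff2 (f k) i j)"
  by (simp add: coeff2_def coeff_sum)

lemma poly2_smult: "poly2 (smult [:c:] p) x y = c * poly2 p x y"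
  by (simp add: poly2_def)

lemma coeff2_smult: "coeff2 (smult [:c:] p) i j = c * coeff2 p i j"
  by (simp add: coeff2_def)

lemma poly2_eqI: "(\<And>i j. coeff2 p i j = coeff2 p' i j) \<Longrightarrow> p = p'"
  by (intro poly_eqI) (simp add: coeff2_def)

definition tensor :: "real poly \<Rightarrow> real poly \<Rightarrow> real poly poly" where
  "tensor P Q = map_poly (\<lambda>c. smult c Q) P"

lemma coeff2_tensor: "coeff2 (tensor P Q) i j = coeff P i * coeff Q j"
  by (simp add: tensor_def coeff2_def coeff_map_poly)

lemma poly2_tensor: "poly2 (tensor P Q) x y = poly P x * poly Q y"
proof (induction P)
  case (pCons c P)
  have "tensor (pCons c P) Q = pCons (smult c Q) (tensor P Q)"
    by (intro poly2_eqI) (auto simp: coeff2_tensor coeff2_def coeff_pCons tensor_def coeff_map_poly split: nat.splits)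
  thus ?case using pCons.IH by (simp add: poly2_pCons algebra_simps)
qed (simp add: tensor_def)

text \<open>Serves to turn the reverse lexicographical ordering into the lexicographical
  one.\<close>

definition swap_xy :: "real poly poly \<Rightarrow> real poly poly" where
  "swap_xy p = (\<Sum>i\<le>degree p. map_poly (\<lambda>c. monom c i) (coeff p i))"

lemma coeff2_swap_xy [simp]: "coeff2 (swap_xy p) i j = coeff2 p j i"
proof -
  have "coeff2 (swap_xy p) i j = (\<Sum>n\<le>degree p. if n = j then coeff (coeff p n) i else 0)"
    by (auto simp: swap_xy_def coeff2_def coeff_sum coeff_map_poly intro!: sum.cong)
  thus ?thesis by (simp add: coeff2_def coeff_eq_0)
qed

lemma swap_xy_swap_xy [simp]: "swap_xy (swap_xy p) = p"
  by (rule poly2_eqI) simp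

lemma poly_eq_sum_bound:
  fixes p :: "'a::comm_semiring_1 poly"
  assumes "degree p \<le> n"
  shows "poly p x = (\<Sum>i\<le>n. coeff p i * x ^ i)"
  unfolding poly_altdef using assms by (intro sum.mono_neutral_left) (auto simp: coeff_eq_0)

text \<open>A fixed rectangle containing the support replaces the varying degree bounds, so that
  integrals can be taken term by term.\<close>

lemma poly2_eq_sum_bounds:
  assumes "\<And>i j. coeff2 p i j \<noteq> 0 \<Longrightarrow> i \<le> D \<and> j \<le> E"
  shows "poly2 p x y = (\<Sum>(i, j)\<in>{..D} \<times> {..E}. coeff2 p i j * (x ^ i * y ^ j))"
proof -
  have dD: "degree p \<le> D"
    using assms by (intro degree_le) (force simp: coeff2_def poly_eq_iff)
  have dE: "degree (coeff p i) \<le> E" for i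
    using assms by (intro degree_le) (force simp: coeff2_def)
  have "poly2 p x y = (\<Sum>i\<le>D. poly (coeff p i) y * x ^ i)"
    unfolding poly2_def poly_eq_sum_bound[OF dD] by (simp add: poly_sum)
  also have "\<dots> = (\<Sum>i\<le>D. \<Sum>j\<le>E. coeff2 p i j * (x ^ i * y ^ j))"
    unfolding poly_eq_sum_bound[OF dE] by (simp add: sum_distrib_right sum_distrib_left coeff2_def mult_ac)
  finally show ?thesis by (simp add: sum.cartesian_product)
qed

lemma poly2_bounds_exist: "\<exists>B. \<forall>i j. coeff2 p i j \<noteq> 0 \<longrightarrow> i \<le> B \<and> j \<le> B"
proof -
  define B where "B = Max (insert (degree p) ((\<lambda>i. degree (coeff p i)) ` {..degree p}))"
  have "i \<le> B \<and> j \<le> B" if "coeff2 p i j \<noteq> 0" for i j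
  proof -
    have "j \<le> degree (coeff p i)" "coeff p i \<noteq> 0"
      using that by (auto simp: coeff2_def intro: le_degree)
    moreover from this have "i \<le> degree p" by (auto intro: le_degree)
    moreover from this have "degree (coeff p i) \<le> B" unfolding B_def by (intro Max_ge) auto
    moreover have "degree p \<le> B" unfolding B_def by (intro Max_ge) auto
    ultimately show ?thesis by auto
  qed
  thus ?thesis by blast
qed

lemma poly2_swap_xy: "poly2 (swap_xy p) x y = poly2 p y x"
proof -
  obtain B where B: "\<And>i j. coeff2 p i j \<noteq> 0 \<Longrightarrow> i \<le> B \<and> j \<le> B"
    using poly2_bounds_exist by blast
  have "poly2 (swap_xy p) x y = (\<Sum>(i, j)\<in>{..B} \<times> {..B}. coeff2 p j i * (x ^ i * y ^ j))"
    by (subst poly2_eq_sum_bounds[where D = B and E = B]) (use B in auto)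
  also have "\<dots> = (\<Sum>i\<le>B. \<Sum>j\<le>B. coeff2 p j i * (x ^ i * y ^ j))"
    by (simp add: sum.cartesian_product)
  also have "\<dots> = (\<Sum>j\<le>B. \<Sum>i\<le>B. coeff2 p j i * (y ^ j * x ^ i))"
    by (subst sum.swap) (simp add: mult_ac)
  also have "\<dots> = poly2 p y x"
    by (subst poly2_eq_sum_bounds[where D = B and E = B]) (use B in \<open>auto simp: sum.cartesian_product\<close>)
  finally show ?thesis .
qed

lemma continuous_on_poly2 [continuous_intros]:
  "continuous_on A f \<Longrightarrow> continuous_on A g \<Longrightarrow> continuous_on A (\<lambda>z. poly2 p (f z) (g z))"
  unfolding poly2_eq_sum by (intro continuous_intros)

text \<open>Roots are counted twice: for fixed x the polynomial in y has infinitely many, so it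
  vanishes; then \<open>p\<close>, over the domain of polynomials in y, has infinitely many constant
  roots.\<close>

lemma poly2_eq_0_on_square:
  assumes "\<And>x y. x \<in> {-1<..<1} \<Longrightarrow> y \<in> {-1<..<1} \<Longrightarrow> poly2 p x y = 0"
  shows "p = 0"
proof (rule ccontr)
  assume "p \<noteq> 0"
  have inf: "infinite {-1<..<1::real}" by simp
  have "poly p [:x:] = 0" if x: "x \<in> {-1<..<1}" for x
  proof (rule ccontr)
    assume "poly p [:x:] \<noteq> 0"
    from poly_roots_finite[OF this] have "finite {-1<..<1::real}"
      by (rule rev_finite_subset) (use assms[OF x] in \<open>auto simp: poly2_def\<close>)
    thus False using inf by simp
  qed
  hence "(\<lambda>x. [:x:]) ` {-1<..<1} \<subseteq> {z. poly p z = 0}" by auto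
  hence "finite ((\<lambda>x::real. [:x:]) ` {-1<..<1})"
    using poly_roots_finite[OF \<open>p \<noteq> 0\<close>] by (rule finite_subset)
  thus False using inf by (subst (asm) finite_image_iff) (auto simp: inj_on_def)
qed

section \<open>Definiteness of the scalar product and uniqueness\<close>

context bernstein_szego_weight
begin

text \<open>Every monomial of \<open>p\<close> except the leading one lies in the range that
  \<open>F\<close> annihilates.\<close>

lemma integral_mu_poly2:
  assumes F: "continuous_on UNIV (\<lambda>(x, y). F x y)"
    and supp: "\<And>i j. coeff2 p i j \<noteq> 0 \<Longrightarrow> j \<le> m \<and> (lex_less (i, j) (r, k) \<or> (i, j) = (r, k))"
    and orth: "\<And>i j. i < r \<and> j \<le> m \<or> i = r \<and> j < k \<Longrightarrow>
      (\<integral>(x, y). F x y * (x ^ i * y ^ j) \<partial>mu N a) = 0"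
    and "k \<le> m"
  shows "(\<integral>(x, y). F x y * poly2 p x y \<partial>mu N a) =
      coeff2 p r k * (\<integral>(x, y). F x y * (x ^ r * y ^ k) \<partial>mu N a)"
proof -
  let ?I = "\<lambda>i j. \<integral>(x, y). F x y * (x ^ i * y ^ j) \<partial>mu N a"
  have B: "i \<le> r \<and> j \<le> m" if "coeff2 p i j \<noteq> 0" for i j
    using supp[OF that] by (auto simp: lex_less_def)
  have int: "integrable (mu N a) (\<lambda>(x, y). c * (F x y * (x ^ i * y ^ j)))" for c i j
    using F by (intro integrable_mu) (auto simp: case_prod_unfold intro!: continuous_intros)
  have "(\<integral>(x, y). F x y * poly2 p x y \<partial>mu N a) =
     (\<integral>z. (\<Sum>(i, j)\<in>{..r} \<times> {..m}. case z of (x, y) \<Rightarrow> coeff2 p i j * (F x y * (x ^ i * y ^ j))) \<partial>mu N a)"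
    by (intro Bochner_Integration.integral_cong refl)
       (auto simp: poly2_eq_sum_bounds[OF B] sum_distrib_left case_prod_unfold mult_ac intro!: sum.cong)
  also have "\<dots> = (\<Sum>(i, j)\<in>{..r} \<times> {..m}. \<integral>(x, y). coeff2 p i j * (F x y * (x ^ i * y ^ j)) \<partial>mu N a)"
    unfolding case_prod_unfold
    by (subst Bochner_Integration.integral_sum) (use int in \<open>auto simp: case_prod_unfold\<close>)
  also have "\<dots> = (\<Sum>(i, j)\<in>{..r} \<times> {..m}. coeff2 p i j * ?I i j)"
    by (simp add: case_prod_unfold)
  also have "\<dots> = (\<Sum>z\<in>{..r} \<times> {..m}. if z = (r, k) then coeff2 p r k * ?I r k else 0)"
  proof (intro sum.cong refl)
    fix z assume "z \<in> {..r} \<times> {..m}"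
    show "(case z of (i, j) \<Rightarrow> coeff2 p i j * ?I i j) = (if z = (r, k) then coeff2 p r k * ?I r k else 0)"
    proof (cases z)
      case (Pair i j)
      show ?thesis
        using supp[of i j] orth[of i j] unfolding Pair by (auto simp: lex_less_def)
    qed
  qed
  also have "\<dots> = coeff2 p r k * ?I r k"
    using \<open>k \<le> m\<close> by simp
  finally show ?thesis .
qed

text \<open>A continuous nonnegative integrand with zero integral vanishes inside the square, and
  there the weight is positive.\<close>

lemma integral_mu_square_eq_0:
  assumes "(\<integral>(x, y). (poly2 p x y)\<^sup>2 \<partial>mu N a) = 0"
  shows "p = 0"
proof (rule poly2_eq_0_on_square)
  fix x y :: real assume xy: "x \<in> {-1<..<1}" "y \<in> {-1<..<1}"
  let ?f = "\<lambda>z. (poly2 p (fst z) (snd z))\<^sup>2 * (case z of (x, y) \<Rightarrow> weight N a x y)"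
  have c: "continuous_on UNIV (\<lambda>z. (poly2 p (fst z) (snd z))\<^sup>2)" by (intro continuous_intros)
  have cf: "continuous_on (cbox (-1, -1) (1, 1)) ?f"
    by (intro continuous_on_mult continuous_on_weight continuous_intros)
  have "integral (cbox (-1, -1) (1, 1)) ?f = 0"
    using assms integral_mu[OF c] by (simp add: case_prod_unfold)
  hence "(?f has_integral 0) (cbox (-1, -1) (1, 1))"
    using integrable_continuous[OF cf] by (metis has_integral_integral)
  moreover have "0 \<le> ?f z" if "z \<in> box (-1, -1) (1, 1)" for z
  proof -
    have "z \<in> cbox (-1, -1) (1, 1)" using that box_subset_cbox by blast
    thus ?thesis using weight_nonneg by (cases z) auto
  qed
  moreover have "(0, 0) \<in> box (-1, -1) (1 :: real, 1 :: real)" by (auto simp: mem_box Basis_prod_def)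
  ultimately have "?f (x, y) = 0"
    using xy by (intro has_integral_0_cbox_imp_0[OF cf]) auto
  thus "poly2 p x y = 0" using weight_pos[OF xy] by simp
qed

text \<open>The scalar product of \<open>p\<close> and \<open>p'\<close> can be evaluated through
  either leading coefficient. With the unit norms this makes the leading coefficients equal, the
  scalar product 1, and the squared norm of p - p' equal to 1 - 2 + 1 = 0.\<close>

lemma is_lex_op_unique:
  assumes p: "is_lex_op (mu N a) m r k p" and p': "is_lex_op (mu N a) m r k p'" and "k \<le> m"
  shows "p = p'"
proof -
  let ?c = "coeff2 p r k" and ?c' = "coeff2 p' r k"
  let ?X = "\<integral>(x, y). poly2 p x y * (x ^ r * y ^ k) \<partial>mu N a"
  let ?X' = "\<integral>(x, y). poly2 p' x y * (x ^ r * y ^ k) \<partial>mu N a"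
  have E: "(\<integral>(x, y). poly2 u x y * poly2 v x y \<partial>mu N a) =
      coeff2 v r k * (\<integral>(x, y). poly2 u x y * (x ^ r * y ^ k) \<partial>mu N a)"
    if "is_lex_op (mu N a) m r k u" "is_lex_op (mu N a) m r k v" for u v
    using that \<open>k \<le> m\<close> unfolding is_lex_op_def
    by (intro integral_mu_poly2[of _ _ m]) (auto simp: case_prod_unfold intro!: continuous_intros)
  have pos: "?c > 0" "?c' > 0"
    and norm: "(\<integral>(x, y). poly2 p x y * poly2 p x y \<partial>mu N a) = 1"
      "(\<integral>(x, y). poly2 p' x y * poly2 p' x y \<partial>mu N a) = 1"
    using p p' by (auto simp: is_lex_op_def power2_eq_square)
  have X: "?c * ?X = 1" "?c' * ?X' = 1"
    using E[OF p p] E[OF p' p'] norm by auto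
  have "(\<integral>(x, y). poly2 p x y * poly2 p' x y \<partial>mu N a) = (\<integral>(x, y). poly2 p' x y * poly2 p x y \<partial>mu N a)"
    by (simp add: mult.commute)
  hence pp': "(\<integral>(x, y). poly2 p x y * poly2 p' x y \<partial>mu N a) = ?c' * ?X" and "?c' * ?X = ?c * ?X'"
    using E[OF p p'] E[OF p' p] by auto
  \<comment> \<open>From c X = c' X' = 1 and c' X = c X' follows c'^2 = c^2; positivity settles the
    sign.\<close>
  have "?c' * ?c' = ?c' * ?c' * (?c * ?X)" using X by simp
  also have "\<dots> = ?c' * ?c * (?c' * ?X)" by simp
  also have "\<dots> = ?c' * ?c * (?c * ?X')" using \<open>?c' * ?X = ?c * ?X'\<close> by simp
  also have "\<dots> = ?c * ?c * (?c' * ?X')" by simp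
  also have "\<dots> = ?c * ?c" using X by simp
  finally have "?c = ?c'" using pos by (metis abs_of_pos real_sqrt_abs2)
  hence 1: "(\<integral>(x, y). poly2 p x y * poly2 p' x y \<partial>mu N a) = 1" using pp' X by simp
  have int: "integrable (mu N a) (\<lambda>(x, y). poly2 u x y * poly2 v x y)" for u v
    by (intro integrable_mu) (auto simp: case_prod_unfold intro!: continuous_intros)
  have "(\<integral>(x, y). (poly2 (p - p') x y)\<^sup>2 \<partial>mu N a) =
      (\<integral>z. (case z of (x, y) \<Rightarrow> poly2 p x y * poly2 p x y) - 2 * (case z of (x, y) \<Rightarrow> poly2 p x y * poly2 p' x y)
        + (case z of (x, y) \<Rightarrow> poly2 p' x y * poly2 p' x y) \<partial>mu N a)"
    by (intro Bochner_Integration.integral_cong refl)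
       (auto simp: poly2_diff power2_eq_square algebra_simps)
  also have "\<dots> = 1 - 2 * 1 + 1"
    using int norm 1 by simp
  finally have "p - p' = 0" by (intro integral_mu_square_eq_0) simp
  thus ?thesis by simp
qed

lemma op_lex_eqI:
  "is_lex_op (mu N a) m r k p \<Longrightarrow> k \<le> m \<Longrightarrow> op_lex N a m r k = p"
  unfolding op_lex_def using is_lex_op_unique by blast

text \<open>Holds because \<open>mu\<close> is invariant under the exchange of the
  variables.\<close>

lemma is_revlex_op_iff: "is_revlex_op (mu N a) n t l p \<longleftrightarrow> is_lex_op (mu N a) n t l (swap_xy p)"
proof -
  have 1: "(\<integral>(x, y). (poly2 p y x)\<^sup>2 \<partial>mu N a) = (\<integral>(x, y). (poly2 p x y)\<^sup>2 \<partial>mu N a)"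
    by (rule integral_mu_swap) (auto simp: case_prod_unfold intro!: continuous_intros)
  have 2: "(\<integral>(x, y). poly2 p y x * (x ^ i * y ^ j) \<partial>mu N a) =
      (\<integral>(x, y). poly2 p x y * (x ^ j * y ^ i) \<partial>mu N a)" for i j
  proof -
    have "continuous_on UNIV (\<lambda>(x, y). poly2 p x y * (x ^ j * y ^ i))"
      by (auto simp: case_prod_unfold intro!: continuous_intros)
    from integral_mu_swap[OF this] show ?thesis by (simp add: mult_ac)
  qed
  show ?thesis
    unfolding is_revlex_op_def is_lex_op_def revlex_less_def lex_less_def poly2_swap_xy coeff2_swap_xy 1 2
    by auto
qed

lemma op_revlex_eqI:
  assumes "is_lex_op (mu N a) n t l p" "l \<le> n"
  shows "op_revlex N a n t l = swap_xy p"
  unfolding op_revlex_def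
proof (rule the_equality)
  show "is_revlex_op (mu N a) n t l (swap_xy p)"
    using assms by (simp add: is_revlex_op_iff)
  fix u assume "is_revlex_op (mu N a) n t l u"
  hence "swap_xy u = p" using assms is_lex_op_unique is_revlex_op_iff by blast
  thus "u = swap_xy p" by auto
qed

end

section \<open>Expansion in products of Chebyshev polynomials\<close>

text \<open>Gaussian elimination: each equation removes at most one unknown, so at least one unknown
  stays free.\<close>

lemma homogeneous_system_nontrivial:
  fixes c :: "'i \<Rightarrow> 'j \<Rightarrow> real"
  assumes "finite I" "finite J" "card I < card J"
  shows "\<exists>x. (\<exists>j\<in>J. x j \<noteq> 0) \<and> (\<forall>i\<in>I. (\<Sum>j\<in>J. c i j * x j) = 0)"
  using assms
proof (induction I arbitrary: J c rule: finite_induct)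
  case empty
  hence "J \<noteq> {}" by auto
  thus ?case by (intro exI[of _ "\<lambda>_. 1"]) auto
next
  case (insert i0 I)
  show ?case
  proof (cases "\<forall>j\<in>J. c i0 j = 0")
    case True
    from insert.IH[of J c] insert.prems insert.hyps obtain x where
      "\<exists>j\<in>J. x j \<noteq> 0" "\<forall>i\<in>I. (\<Sum>j\<in>J. c i j * x j) = 0" by auto
    thus ?thesis using True by (intro exI[of _ x]) auto
  next
    case False
    then obtain j0 where j0: "j0 \<in> J" "c i0 j0 \<noteq> 0" by auto
    define J' where "J' = J - {j0}"
    \<comment> \<open>Row reduction: subtracting a multiple of equation \<open>i0\<close> clears the
      pivot unknown \<open>j0\<close> from every other equation.\<close>
    define c' where "c' = (\<lambda>i j. c i j - c i j0 * c i0 j / c i0 j0)"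
    have J': "finite J'" "j0 \<notin> J'" "J = insert j0 J'"
      using insert.prems j0 by (auto simp: J'_def)
    from insert.IH[of J' c'] insert.prems insert.hyps J' obtain x where
      x: "\<exists>j\<in>J'. x j \<noteq> 0" "\<forall>i\<in>I. (\<Sum>j\<in>J'. c' i j * x j) = 0" by auto
    \<comment> \<open>The pivot unknown is recovered from equation \<open>i0\<close>.\<close>
    define t where "t = - (\<Sum>j\<in>J'. c i0 j * x j) / c i0 j0"
    define x' where "x' = x(j0 := t)"
    have S: "(\<Sum>j\<in>J. c i j * x' j) = c i j0 * t + (\<Sum>j\<in>J'. c i j * x j)" for i
    proof -
      have "(\<Sum>j\<in>J'. c i j * x' j) = (\<Sum>j\<in>J'. c i j * x j)"
        using J' by (intro sum.cong) (auto simp: x'_def)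
      thus ?thesis using J' by (simp add: x'_def)
    qed
    have "(\<Sum>j\<in>J. c i j * x' j) = 0" if "i \<in> I" for i
    proof -
      have "0 = (\<Sum>j\<in>J'. c' i j * x j)" using x that by simp
      also have "\<dots> = (\<Sum>j\<in>J'. c i j * x j) - (\<Sum>j\<in>J'. c i j0 / c i0 j0 * (c i0 j * x j))"
        unfolding sum_subtractf[symmetric] by (intro sum.cong) (simp_all add: c'_def algebra_simps)
      also have "\<dots> = (\<Sum>j\<in>J. c i j * x' j)"
        unfolding S t_def sum_distrib_left[symmetric] by simp
      finally show ?thesis by simp
    qed
    moreover have "(\<Sum>j\<in>J. c i0 j * x' j) = 0"
      unfolding S t_def using j0 by simp
    moreover have "\<exists>j\<in>J. x' j \<noteq> 0"
      using x(1) J' by (auto simp: x'_def)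
    ultimately show ?thesis by (intro exI[of _ x']) auto
  qed
qed

section \<open>The polynomial V with omega(z,w) = V(zw), and Chebyshev expansions derived from
  it\<close>

definition omega_poly :: "nat \<Rightarrow> (nat \<Rightarrow> real) \<Rightarrow> real poly" where
  "omega_poly N a = (\<Prod>i=1..N. [:1, a i:])"

lemma omega_poly_Suc: "omega_poly (Suc N) a = [:1, a (Suc N):] * omega_poly N a"
  unfolding omega_poly_def by (rule prod.nat_ivl_Suc') simp

lemma degree_omega_poly_le: "degree (omega_poly N a) \<le> N"
proof (induction N)
  case (Suc N)
  have "degree (omega_poly (Suc N) a) \<le> degree [:1, a (Suc N):] + degree (omega_poly N a)"
    unfolding omega_poly_Suc by (rule degree_mult_le)
  also have "\<dots> \<le> 1 + N" using Suc by (intro add_mono) auto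
  finally show ?case by simp
qed (simp add: omega_poly_def)

lemma coeff_omega_poly_0: "coeff (omega_poly N a) 0 = 1"
  by (simp add: omega_poly_def poly_0_coeff_0[symmetric] poly_prod)

lemma omega_eq_sum: "omega N a z w = (\<Sum>p\<le>N. of_real (coeff (omega_poly N a) p) * (z * w) ^ p)"
proof -
  have "omega N a z w = cpoly (omega_poly N a) (z * w)"
  proof (induction N)
    case (Suc N)
    have "omega_poly (Suc N) a = omega_poly N a + smult (a (Suc N)) (pCons 0 (omega_poly N a))"
      by (simp add: omega_poly_Suc)
    hence "cpoly (omega_poly (Suc N) a) (z * w) = (1 + of_real (a (Suc N)) * (z * w)) * cpoly (omega_poly N a) (z * w)"
      by (simp only: cpoly_add cpoly_smult cpoly_pCons) (simp add: algebra_simps)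
    thus ?case using Suc by (simp add: omega_def mult_ac)
  qed (simp add: omega_def omega_poly_def)
  also have "\<dots> = (\<Sum>p\<le>N. of_real (coeff (omega_poly N a) p) * (z * w) ^ p)"
  proof -
    have "degree (map_poly complex_of_real (omega_poly N a)) \<le> N"
      using degree_omega_poly_le[of N a] by (intro degree_le) (auto simp: coeff_map_poly intro: coeff_eq_0)
    from poly_eq_sum_bound[OF this] show ?thesis by (simp add: coeff_map_poly)
  qed
  finally show ?thesis .
qed

text \<open>Put w = \<open>cis t\<close> in the product of the expansions of omega(z,w) and
  omega(z,1/w) and compare powers of z: a pair with p + p' = i contributes w^(p-p').\<close>

lemma poly_h_coeff_cos:
  assumes "i \<le> 2 * N"
  shows "poly (h_coeff N a i) (cos t) =
    (\<Sum>p\<le>N. \<Sum>p'\<le>N. if p + p' = i then coeff (omega_poly N a) p * coeff (omega_poly N a) p' * cos ((real p - real p') * t) else 0)"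
proof -
  let ?e = "coeff (omega_poly N a)"
  let ?c = "\<lambda>i. \<Sum>p\<le>N. \<Sum>p'\<le>N. if p + p' = i then of_real (?e p * ?e p') * cis ((real p - real p') * t) else 0"
  have 1: "1 / cis t = cis (- t)" by (simp add: divide_inverse)
  have y: "of_real (cos t) = (cis t + 1 / cis t) / 2"
    unfolding 1 by (simp add: complex_eq_iff)
  have "(\<Sum>i\<le>2*N. of_real (poly (h_coeff N a i) (cos t)) * z ^ i) = (\<Sum>i\<le>2*N. ?c i * z ^ i)" for z
  proof -
    have "(\<Sum>i\<le>2*N. of_real (poly (h_coeff N a i) (cos t)) * z ^ i) = omega N a z (cis t) * omega N a z (cis (- t))"
      unfolding h_of_real[symmetric] y by (subst h_eq_omega) (simp_all add: 1)
    also have "\<dots> = (\<Sum>p\<le>N. \<Sum>p'\<le>N. of_real (?e p * ?e p') * cis ((real p - real p') * t) * z ^ (p + p'))"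
    proof -
      have "cis t ^ p * cis (- t) ^ p' = cis ((real p - real p') * t)" for p p'
        by (simp only: Complex.DeMoivre cis_mult) (simp add: algebra_simps)
      hence "(of_real (?e p) * (z * cis t) ^ p) * (of_real (?e p') * (z * cis (- t)) ^ p') =
          of_real (?e p * ?e p') * cis ((real p - real p') * t) * z ^ (p + p')" for p p'
        by (simp add: power_mult_distrib power_add)
      thus ?thesis unfolding omega_eq_sum sum_product by (simp only:)
    qed
    also have "\<dots> = (\<Sum>p\<le>N. \<Sum>p'\<le>N. \<Sum>i\<le>2*N.
        if p + p' = i then of_real (?e p * ?e p') * cis ((real p - real p') * t) * z ^ i else 0)"
      by (intro sum.cong refl) simp
    also have "\<dots> = (\<Sum>i\<le>2*N. \<Sum>p\<le>N. \<Sum>p'\<le>N.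
        if p + p' = i then of_real (?e p * ?e p') * cis ((real p - real p') * t) * z ^ i else 0)"
      by (simp only: sum.swap[of _ "{..2*N}" "{..N}"])
    also have "\<dots> = (\<Sum>i\<le>2*N. ?c i * z ^ i)"
      unfolding sum_distrib_right by (intro sum.cong refl) simp
    finally show ?thesis .
  qed
  hence "of_real (poly (h_coeff N a i) (cos t)) = ?c i"
    using polyfun_eq_coeffs[of "\<lambda>i. of_real (poly (h_coeff N a i) (cos t))" "2*N" ?c] assms by auto
  \<comment> \<open>The left side is real, so real parts replace each exponential by a
    cosine.\<close>
  from arg_cong[OF this, of Re] show ?thesis
    by (simp add: if_distrib cong: if_cong)
qed

text \<open>Every point of (-1,1) is such a cosine, which is more than finitely many roots allow.
  Leaving out zeros of sine permits division by sin t when the lemma is applied.\<close>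

lemma poly_eqI_cos:
  assumes "\<And>t. sin t \<noteq> 0 \<Longrightarrow> poly P (cos t) = poly P' (cos t :: real)"
  shows "P = P'"
proof (rule ccontr)
  assume "P \<noteq> P'"
  hence "finite {y. poly (P - P') y = 0}" by (intro poly_roots_finite) simp
  moreover have "{-1<..<1} \<subseteq> {y. poly (P - P') y = 0}"
  proof
    fix y :: real assume y: "y \<in> {-1<..<1}"
    have "sin (arccos y) \<noteq> 0" using y sin_arccos_nonzero by auto
    thus "y \<in> {y. poly (P - P') y = 0}" using assms[of "arccos y"] y by simp
  qed
  ultimately have "finite {-1<..<1::real}" by (rule rev_finite_subset)
  thus False using infinite_Ioo[of "-1" "1::real"] by simp
qed

text \<open>The product of cosine and sine splits into shifts by p - p' and p' - p with weight one
  half each. The coefficients are symmetric in p and p', so renaming merges the two halves.\<close>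

lemma h_coeff_mult_cheb_U:
  assumes "i \<le> 2 * N"
  shows "h_coeff N a i * cheb_U k = (\<Sum>p\<le>N. \<Sum>p'\<le>N.
    smult (if p + p' = i then coeff (omega_poly N a) p * coeff (omega_poly N a) p' else 0) (cheb_U (k + int p - int p')))"
proof (rule poly_eqI_cos)
  fix t :: real assume t: "sin t \<noteq> 0"
  let ?e = "\<lambda>p p'. if p + p' = i then coeff (omega_poly N a) p * coeff (omega_poly N a) p' else 0"
  let ?s = "\<lambda>p p'. sin (of_int (k + 1) * t + (real p - real p') * t)"
  have "sin t * poly (h_coeff N a i * cheb_U k) (cos t) =
      (\<Sum>p\<le>N. \<Sum>p'\<le>N. ?e p p' * cos ((real p - real p') * t)) * sin (of_int (k + 1) * t)"
    unfolding sin_cheb_U[symmetric] by (simp add: poly_h_coeff_cos[OF assms] if_distrib if_distribR mult_ac cong: if_cong)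
  also have "\<dots> = (\<Sum>p\<le>N. \<Sum>p'\<le>N. ?e p p' * ?s p p' / 2 + ?e p' p * ?s p' p / 2)"
    unfolding sum_distrib_right
  proof (intro sum.cong refl)
    fix p p'
    have "(real p' - real p) * t = - ((real p - real p') * t)" by (simp add: algebra_simps)
    thus "?e p p' * cos ((real p - real p') * t) * sin (of_int (k + 1) * t) =
        ?e p p' * ?s p p' / 2 + ?e p' p * ?s p' p / 2"
      by (simp only: sin_add sin_minus cos_minus) (simp add: field_simps add.commute)
  qed
  also have "\<dots> = (\<Sum>p\<le>N. \<Sum>p'\<le>N. ?e p p' * ?s p p' / 2) + (\<Sum>p\<le>N. \<Sum>p'\<le>N. ?e p' p * ?s p' p / 2)"
    by (simp only: sum.distrib)
  also have "(\<Sum>p\<le>N. \<Sum>p'\<le>N. ?e p' p * ?s p' p / 2) = (\<Sum>p\<le>N. \<Sum>p'\<le>N. ?e p p' * ?s p p' / 2)"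
    by (rule sum.swap)
  also have "(\<Sum>p\<le>N. \<Sum>p'\<le>N. ?e p p' * ?s p p' / 2) + \<dots> = (\<Sum>p\<le>N. \<Sum>p'\<le>N. ?e p p' * ?s p p')"
    unfolding sum.distrib[symmetric] by (intro sum.cong refl) simp
  also have "\<dots> = sin t * poly (\<Sum>p\<le>N. \<Sum>p'\<le>N. smult (?e p p') (cheb_U (k + int p - int p'))) (cos t)"
  proof -
    have "?s p p' = sin t * U (k + int p - int p') (cos t)" for p p'
      unfolding sin_cheb_U by (simp add: algebra_simps)
    thus ?thesis
      unfolding poly_sum poly_smult sum_distrib_left by (intro sum.cong refl) simp
  qed
  finally show "poly (h_coeff N a i * cheb_U k) (cos t) =
      poly (\<Sum>p\<le>N. \<Sum>p'\<le>N. smult (?e p p') (cheb_U (k + int p - int p'))) (cos t)"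
    using t by simp
qed

text \<open>The index i of \<open>q\<close> only records the value p + p', so exchanging the sums
  removes it.\<close>

lemma q_mult_cheb_U:
  "q N a r x y * U k y = (\<Sum>p\<le>N. \<Sum>p'\<le>N. coeff (omega_poly N a) p * coeff (omega_poly N a) p' *
     (U (int r - int p - int p') x * U (k + int p - int p') y))"
proof -
  let ?e = "coeff (omega_poly N a)"
  have "q N a r x y * U k y = (\<Sum>i\<le>2*N. poly (h_coeff N a i * cheb_U k) y * U (int r - int i) x)"
    by (simp add: q_def sum_distrib_left sum_distrib_right atLeast0AtMost mult_ac)
  also have "\<dots> = (\<Sum>i\<le>2*N. \<Sum>p\<le>N. \<Sum>p'\<le>N.
      if p + p' = i then ?e p * ?e p' * (U (int r - int i) x * U (k + int p - int p') y) else 0)"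
  proof (intro sum.cong refl)
    fix i assume i: "i \<in> {..2*N}"
    show "poly (h_coeff N a i * cheb_U k) y * U (int r - int i) x = (\<Sum>p\<le>N. \<Sum>p'\<le>N.
      if p + p' = i then ?e p * ?e p' * (U (int r - int i) x * U (k + int p - int p') y) else 0)"
      using i by (subst h_coeff_mult_cheb_U)
        (auto simp: poly_sum sum_distrib_left sum_distrib_right intro!: sum.cong)
  qed
  also have "\<dots> = (\<Sum>p\<le>N. \<Sum>p'\<le>N. \<Sum>i\<le>2*N.
      if p + p' = i then ?e p * ?e p' * (U (int r - int i) x * U (k + int p - int p') y) else 0)"
    by (simp only: sum.swap[of _ "{..N}" "{..2*N}"])
  also have "\<dots> = (\<Sum>p\<le>N. \<Sum>p'\<le>N. ?e p * ?e p' *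
     (U (int r - int p - int p') x * U (k + int p - int p') y))"
    by (intro sum.cong refl) (simp add: algebra_simps)
  finally show ?thesis .
qed

section \<open>Combinations of V and its reflection\<close>

lemma degree_omega_poly:
  assumes "\<And>i. i \<in> {1..N} \<Longrightarrow> a i \<noteq> 0"
  shows "degree (omega_poly N a) = N"
  unfolding omega_poly_def using assms by (subst degree_prod_eq_sum_degree) auto

text \<open>The roots are -1/a_i and -a_j, and a common one would require a_i a_j = 1. For two
  linear factors the constant 1 - a_i a_j is an explicit combination of them.\<close>

lemma coprime_reflect_omega_poly:
  assumes "\<And>i. i \<in> {1..N} \<Longrightarrow> a i \<noteq> 0" "\<And>i. i \<in> {1..N} \<Longrightarrow> \<bar>a i\<bar> < 1"
  shows "coprime (omega_poly N a) (reflect_poly (omega_poly N a))"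
proof -
  have r: "reflect_poly (omega_poly N a) = (\<Prod>i=1..N. [:a i, 1:])"
    unfolding omega_poly_def reflect_poly_prod using assms
    by (intro prod.cong refl) (simp add: reflect_poly_pCons)
  have c: "coprime [:1, a i:] [:a j, 1:]" if "i \<in> {1..N}" "j \<in> {1..N}" for i j
  proof (rule coprimeI)
    fix c assume c: "c dvd [:1, a i:]" "c dvd [:a j, 1:]"
    have "\<bar>a i * a j\<bar> < 1"
      using assms(2)[OF that(1)] assms(2)[OF that(2)] mult_strict_mono[of "\<bar>a i\<bar>" 1 "\<bar>a j\<bar>" 1]
      by (simp add: abs_mult)
    hence "1 - a i * a j \<noteq> 0" by auto
    moreover have "c dvd [:1, a i:] - smult (a i) [:a j, 1:]"
      using c by (intro dvd_diff dvd_smult)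
    ultimately show "is_unit c" by (auto elim: dvd_trans simp: is_unit_const_poly_iff dvd_field_iff)
  qed
  show ?thesis
    unfolding r unfolding omega_poly_def by (intro prod_coprime_left prod_coprime_right c)
qed

text \<open>The coefficients \<open>\<alpha>\<close> enter in reversed order because they multiply powers of \<open>1/u\<close>; the shift
  by \<open>d - 1\<close> clears the denominator, so the coefficient of \<open>u\<^sup>l\<close> sits in degree \<open>l + (d - 1)\<close>.\<close>

definition bezout_comb :: "nat \<Rightarrow> (nat \<Rightarrow> real) \<Rightarrow> nat \<Rightarrow> (nat \<Rightarrow> real) \<Rightarrow> (nat \<Rightarrow> real) \<Rightarrow> real poly" where
  "bezout_comb N a d \<alpha> \<beta> = (\<Sum>j<d. monom (\<alpha> j) (d - 1 - j)) * omega_poly N a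
     + (\<Sum>j<d. monom (\<beta> j) j) * reflect_poly (omega_poly N a)"

lemma bezout_comb_scale: "bezout_comb N a d (\<lambda>j. c * \<alpha> j) (\<lambda>j. c * \<beta> j) = smult c (bezout_comb N a d \<alpha> \<beta>)"
proof -
  have "(\<Sum>j<d. monom (c * f j) (g j)) = smult c (\<Sum>j<d. monom (f j) (g j))" for f g
    by (induction d) (simp_all add: smult_add_right smult_monom)
  thus ?thesis by (simp add: bezout_comb_def smult_add_right)
qed

text \<open>\<open>T\<close> encodes an arbitrary linear functional sending u^n to
  \<open>T n\<close>; products of Chebyshev polynomials will be its values.\<close>

lemma sum_coeff_monom_mult:
  fixes T :: "nat \<Rightarrow> real"
  assumes "degree P \<le> D" "i + D \<le> M"
  shows "(\<Sum>n\<le>M. coeff (monom c i * P) n * T n) = (\<Sum>p\<le>D. c * coeff P p * T (i + p))"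
proof -
  have "(\<Sum>n\<le>M. coeff (monom c i * P) n * T n) = (\<Sum>n=0+i..D+i. c * coeff P (n - i) * T n)"
    using assms by (intro sum.mono_neutral_cong_right) (auto simp: coeff_monom_mult coeff_eq_0)
  also have "\<dots> = (\<Sum>p\<le>D. c * coeff P p * T (i + p))"
    unfolding sum.shift_bounds_cl_nat_ivl by (simp add: atLeast0AtMost add.commute)
  finally show ?thesis .
qed

locale bernstein_szego_nondegenerate = bernstein_szego_weight +
  assumes a_nz: "\<And>i. i \<in> {1..N} \<Longrightarrow> a i \<noteq> 0"
begin

abbreviation e :: "nat \<Rightarrow> real" where "e \<equiv> coeff (omega_poly N a)"

lemma sum_coeff_bezout_comb:
  fixes T :: "nat \<Rightarrow> real"
  assumes "M = N + d - 1"
  shows "(\<Sum>n\<le>M. coeff (bezout_comb N a d \<alpha> \<beta>) n * T n) =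
    (\<Sum>j<d. \<Sum>p\<le>N. e p * (\<alpha> j * T (d - 1 - j + p) + \<beta> j * T (j + N - p)))"
proof -
  have 1: "(\<Sum>n\<le>M. coeff (monom (\<alpha> j) (d - 1 - j) * omega_poly N a) n * T n) =
      (\<Sum>p\<le>N. e p * (\<alpha> j * T (d - 1 - j + p)))" if "j < d" for j
    using assms that degree_omega_poly_le by (subst sum_coeff_monom_mult[where D = N]) (auto simp: mult_ac)
  have 2: "(\<Sum>n\<le>M. coeff (monom (\<beta> j) j * reflect_poly (omega_poly N a)) n * T n) =
      (\<Sum>p\<le>N. e p * (\<beta> j * T (j + N - p)))" if "j < d" for j
  proof -
    have "(\<Sum>n\<le>M. coeff (monom (\<beta> j) j * reflect_poly (omega_poly N a)) n * T n) =
        (\<Sum>p\<le>N. \<beta> j * coeff (reflect_poly (omega_poly N a)) p * T (j + p))"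
      using assms that degree_omega_poly[OF a_nz] degree_reflect_poly_le[of "omega_poly N a"]
      by (intro sum_coeff_monom_mult) auto
    \<comment> \<open>Reversing the summation turns the coefficients of the reflection back into
      \<open>e p\<close>, as the degree of V is exactly N.\<close>
    also have "\<dots> = (\<Sum>p\<le>N. \<beta> j * coeff (reflect_poly (omega_poly N a)) (N - p) * T (j + (N - p)))"
      using sum.atLeastAtMost_rev[of "\<lambda>p. \<beta> j * coeff (reflect_poly (omega_poly N a)) p * T (j + p)" 0 N]
      by (simp add: atLeast0AtMost)
    also have "\<dots> = (\<Sum>p\<le>N. e p * (\<beta> j * T (j + N - p)))"
      using degree_omega_poly[OF a_nz] by (intro sum.cong refl) (simp add: coeff_reflect_poly)
    finally show ?thesis .
  qed
  have "(\<Sum>n\<le>M. coeff (bezout_comb N a d \<alpha> \<beta>) n * T n) =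
     (\<Sum>n\<le>M. \<Sum>j<d. coeff (monom (\<alpha> j) (d - 1 - j) * omega_poly N a) n * T n) +
     (\<Sum>n\<le>M. \<Sum>j<d. coeff (monom (\<beta> j) j * reflect_poly (omega_poly N a)) n * T n)"
    by (simp add: bezout_comb_def sum_distrib_right coeff_sum distrib_right sum.distrib)
  also have "\<dots> = (\<Sum>j<d. \<Sum>p\<le>N. e p * (\<alpha> j * T (d - 1 - j + p))) + (\<Sum>j<d. \<Sum>p\<le>N. e p * (\<beta> j * T (j + N - p)))"
    unfolding sum.swap[of _ "{..<d}" "{..M}"] using 1 2 by simp
  finally show ?thesis by (simp add: distrib_left sum.distrib)
qed

text \<open>By coprimality the reflection of V divides A; its degree N exceeds that of A, so A = 0,
  and then B = 0.\<close>

lemma bezout_comb_eq_0D: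
  assumes "bezout_comb N a d \<alpha> \<beta> = 0" "d \<le> N" "j < d"
  shows "\<alpha> j = 0 \<and> \<beta> j = 0"
proof -
  let ?A = "\<Sum>j<d. monom (\<alpha> j) (d - 1 - j)" and ?B = "\<Sum>j<d. monom (\<beta> j) j"
  let ?W' = "reflect_poly (omega_poly N a)"
  have W0: "omega_poly N a \<noteq> 0" using coeff_omega_poly_0[of N a] by auto
  have W: "coeff (omega_poly N a) 0 \<noteq> 0" "degree (omega_poly N a) = N" "degree ?W' = N" "?W' \<noteq> 0"
    using degree_omega_poly[OF a_nz] by (simp_all add: coeff_omega_poly_0 W0)
  have eq: "?A * omega_poly N a = - ?B * ?W'"
    using assms(1) by (simp add: bezout_comb_def eq_neg_iff_add_eq_0)
  hence "?W' dvd ?A * omega_poly N a" by simp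
  moreover have "coprime ?W' (omega_poly N a)"
    using coprime_reflect_omega_poly[OF a_nz a_less] by (simp add: coprime_commute)
  ultimately have "?W' dvd ?A" by (simp add: coprime_dvd_mult_left_iff)
  moreover have "degree ?A < N"
    using assms(2,3) by (intro degree_sum_less le_less_trans[OF degree_monom_le]) auto
  ultimately have A: "?A = 0"
    by (metis dvd_imp_degree_le W(3) not_less)
  hence "?B = 0" using eq W by simp
  have "coeff ?A (d - 1 - j) = (\<Sum>j'<d. if j' = j then \<alpha> j else 0)"
    unfolding coeff_sum using assms(3) by (intro sum.cong) auto
  moreover have "coeff ?B j = (\<Sum>j'<d. if j' = j then \<beta> j else 0)"
    unfolding coeff_sum by (intro sum.cong) auto
  ultimately show ?thesis using A \<open>?B = 0\<close> assms(3) by simp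
qed

text \<open>Degrees 0 to d-2 and N to N+d-1 impose 2d-1 linear equations on 2d unknowns; a
  nontrivial solution gives a nonzero polynomial by \<open>bezout_comb_eq_0D\<close>.\<close>

lemma bezout_comb_kernel:
  assumes "0 < d" "d \<le> N"
  shows "\<exists>\<alpha> \<beta>. bezout_comb N a d \<alpha> \<beta> \<noteq> 0 \<and> (\<forall>n. n < d - 1 \<or> n \<ge> N \<longrightarrow> coeff (bezout_comb N a d \<alpha> \<beta>) n = 0)"
proof -
  \<comment> \<open>Unknowns 0 to d-1 are the \<open>\<alpha> j\<close>, unknowns d to 2d-1 the
    \<open>\<beta> j\<close>; column j lists the coefficients of the polynomial that unknown j
    multiplies.\<close>
  define c where "c = (\<lambda>n j. if j < d then coeff (monom 1 (d - 1 - j) * omega_poly N a) n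
    else coeff (monom 1 (j - d) * reflect_poly (omega_poly N a)) n)"
  have "card ({..<d-1} \<union> {N..<N+d}) = (d - 1) + d"
    using assms by (subst card_Un_disjoint) auto
  hence "card ({..<d-1} \<union> {N..<N+d}) < card {..<2*d}" using assms by simp
  from homogeneous_system_nontrivial[OF _ _ this, of c] obtain x where
    "\<exists>j\<in>{..<2*d}. x j \<noteq> 0" "\<forall>n\<in>{..<d-1} \<union> {N..<N+d}. (\<Sum>j<2*d. c n j * x j) = 0"
    by auto
  hence
    x: "\<exists>j\<in>{..<2*d}. x j \<noteq> 0"
      "\<And>n. n \<in> {..<d-1} \<union> {N..<N+d} \<Longrightarrow> (\<Sum>j<2*d. c n j * x j) = 0"
    by blast+
  define \<beta> where "\<beta> = (\<lambda>j. x (d + j))"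
  have co: "coeff (bezout_comb N a d x \<beta>) n = (\<Sum>j<2*d. c n j * x j)" for n
  proof -
    have "(\<Sum>j<2*d. c n j * x j) = (\<Sum>j<d. c n j * x j) + (\<Sum>j<d. c n (d + j) * x (d + j))"
      using sum.atLeastLessThan_concat[of 0 d "d + d" "\<lambda>j. c n j * x j"]
        sum.shift_bounds_nat_ivl[of "\<lambda>j. c n j * x j" 0 d d]
      by (simp add: mult_2 atLeast0LessThan add.commute)
    also have "\<dots> = (\<Sum>j<d. coeff (monom (x j) (d - 1 - j) * omega_poly N a) n)
        + (\<Sum>j<d. coeff (monom (\<beta> j) j * reflect_poly (omega_poly N a)) n)"
      by (intro arg_cong2[of _ _ _ _ "(+)"] sum.cong refl)
         (simp_all add: c_def \<beta>_def coeff_monom_mult)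
    finally show ?thesis
      by (simp add: bezout_comb_def sum_distrib_right coeff_sum)
  qed
  \<comment> \<open>From degree N + d on no equation was imposed; there the coefficients vanish for
    reasons of degree.\<close>
  have "degree (bezout_comb N a d x \<beta>) < N + d"
  proof -
    have "degree (bezout_comb N a d x \<beta>) \<le> (d - 1) + N"
      unfolding bezout_comb_def sum_distrib_right
    proof (intro degree_add_le degree_sum_le)
      fix j assume "j \<in> {..<d}"
      hence "degree (monom (x j) (d - 1 - j) * omega_poly N a) \<le> (d - 1 - j) + N"
        using degree_omega_poly_le by (intro order.trans[OF degree_mult_le] add_mono degree_monom_le)
      thus "degree (monom (x j) (d - 1 - j) * omega_poly N a) \<le> (d - 1) + N" by simp
      have "degree (reflect_poly (omega_poly N a)) \<le> N"
        using order.trans[OF degree_reflect_poly_le degree_omega_poly_le] .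
      hence "degree (monom (\<beta> j) j * reflect_poly (omega_poly N a)) \<le> j + N"
        by (intro order.trans[OF degree_mult_le] add_mono degree_monom_le)
      thus "degree (monom (\<beta> j) j * reflect_poly (omega_poly N a)) \<le> (d - 1) + N"
        using \<open>j \<in> {..<d}\<close> by simp
    qed auto
    thus ?thesis using assms by simp
  qed
  hence "coeff (bezout_comb N a d x \<beta>) n = 0" if "n < d - 1 \<or> n \<ge> N" for n
    using that x(2)[of n] unfolding co[symmetric] by (cases "n < N + d") (auto intro: coeff_eq_0)
  moreover have "bezout_comb N a d x \<beta> \<noteq> 0"
  proof
    assume 0: "bezout_comb N a d x \<beta> = 0"
    from x(1) obtain j where j: "j < 2 * d" "x j \<noteq> 0" by auto
    have "\<not> j < d \<Longrightarrow> j - d < d" using j(1) by linarith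
    thus False
      using bezout_comb_eq_0D[OF 0 assms(2), of j] bezout_comb_eq_0D[OF 0 assms(2), of "j - d"] j
      by (cases "j < d") (auto simp: \<beta>_def)
  qed
  ultimately show ?thesis by blast
qed

end

section \<open>The orthonormal polynomials\<close>

lemma coeff_cheb_U_nz: "coeff (cheb_U n) i \<noteq> 0 \<Longrightarrow> int i \<le> max n (- n - 2)"
  using coeff_cheb_U_gt[of n i] by linarith

section \<open>Orthogonality and norm of combinations of \<open>q\<close> and
  \<open>qt\<close>\<close>

context bernstein_szego_weight
begin

lemma integral_mu_q_mult:
  assumes "i \<le> r"
  shows "(\<integral>(x, y). q N a r x y * U k y * (x ^ i * y ^ j) \<partial>mu N a) = (if i = r then
      1 / 2 ^ r * (2 / pi * integral {-1..1} (\<lambda>y. U k y * y ^ j * sqrt (1 - y\<^sup>2))) else 0)"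
proof -
  have "(\<integral>(x, y). q N a r x y * poly (monom 1 i) x * poly (cheb_U k * monom 1 j) y \<partial>mu N a) =
      coeff (monom 1 i) r / 2 ^ r *
        (2 / pi * integral {-1..1} (\<lambda>y. poly (cheb_U k * monom 1 j) y * sqrt (1 - y\<^sup>2)))"
    using assms by (intro integral_mu_q) (simp add: degree_monom_eq)
  thus ?thesis using assms by (simp add: poly_monom mult_ac)
qed

lemma integral_mu_qt_mult:
  assumes "j < t"
  shows "(\<integral>(x, y). qt N a t x y * U l x * (x ^ i * y ^ j) \<partial>mu N a) = 0"
proof -
  have c: "continuous_on UNIV (\<lambda>(x, y). q N a t x y * U l y * (x ^ j * y ^ i))"
    unfolding q_def case_prod_unfold by (intro continuous_intros)
  show ?thesis
    using integral_mu_swap[OF c] integral_mu_q_mult[of j t l i] assms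
    by (simp add: qt_eq_q mult_ac)
qed

context
  fixes P :: "real poly poly" and m r k D :: nat and \<alpha> \<beta> :: "nat \<Rightarrow> real" and v :: "nat \<Rightarrow> int"
  assumes rep: "\<And>x y. poly2 P x y = (\<Sum>j<D. \<alpha> j * q N a (r + j) x y * U (int k - int j) y +
      \<beta> j * qt N a (m + 1 + j) x y * U (v j) x)"
    and D: "D > 0" and k: "k \<le> m"
begin

text \<open>q_{r+s} annihilates x^i unless s = 0 and i = r, and qt_{m+1+s} annihilates every y^j
  with j <= m whatever factor in x accompanies it, so \<open>v\<close> may be arbitrary.\<close>

lemma integral_mu_combination:
  assumes "i \<le> r" "j \<le> m"
  shows "(\<integral>(x, y). poly2 P x y * (x ^ i * y ^ j) \<partial>mu N a) = (if i = r then
      \<alpha> 0 / 2 ^ r * (2 / pi * integral {-1..1} (\<lambda>y. U k y * y ^ j * sqrt (1 - y\<^sup>2))) else 0)"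
proof -
  let ?A = "\<lambda>s (x, y). q N a (r + s) x y * U (int k - int s) y * (x ^ i * y ^ j)"
  let ?B = "\<lambda>s (x, y). qt N a (m + 1 + s) x y * U (v s) x * (x ^ i * y ^ j)"
  have int: "integrable (mu N a) (?A s)" "integrable (mu N a) (?B s)" for s
    by (auto simp: q_def qt_def case_prod_unfold intro!: integrable_mu continuous_intros)
  have "(\<integral>(x, y). poly2 P x y * (x ^ i * y ^ j) \<partial>mu N a) =
      (\<integral>z. (\<Sum>s<D. \<alpha> s * ?A s z + \<beta> s * ?B s z) \<partial>mu N a)"
    by (intro Bochner_Integration.integral_cong refl)
       (auto simp: rep sum_distrib_right sum_distrib_left algebra_simps intro!: sum.cong)
  also have "\<dots> = (\<Sum>s<D. \<alpha> s * (\<integral>z. ?A s z \<partial>mu N a) + \<beta> s * (\<integral>z. ?B s z \<partial>mu N a))"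
    using int by (subst Bochner_Integration.integral_sum) auto
  also have "\<dots> = (\<Sum>s<D. if s = 0 then (if i = r then
      \<alpha> 0 / 2 ^ r * (2 / pi * integral {-1..1} (\<lambda>y. U k y * y ^ j * sqrt (1 - y\<^sup>2))) else 0) else 0)"
    using assms by (intro sum.cong refl) (simp add: integral_mu_q_mult integral_mu_qt_mult)
  also have "\<dots> = (if i = r then
      \<alpha> 0 / 2 ^ r * (2 / pi * integral {-1..1} (\<lambda>y. U k y * y ^ j * sqrt (1 - y\<^sup>2))) else 0)"
    using D by simp
  finally show ?thesis .
qed

text \<open>For i = r what remains is the orthogonality of U_k to lower powers of y.\<close>

lemma combination_orthogonal:
  assumes "i < r \<and> j \<le> m \<or> i = r \<and> j < k"
  shows "(\<integral>(x, y). poly2 P x y * (x ^ i * y ^ j) \<partial>mu N a) = 0"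
  using assms k integral_cheb_U[of "monom 1 j" k]
  by (subst integral_mu_combination) (auto simp: degree_monom_eq poly_monom)

lemma combination_leading:
  "(\<integral>(x, y). poly2 P x y * (x ^ r * y ^ k) \<partial>mu N a) = \<alpha> 0 / 2 ^ (r + k)"
proof -
  have "2 / pi * integral {-1..1} (\<lambda>y. U k y * y ^ k * sqrt (1 - y\<^sup>2)) = 1 / 2 ^ k"
    using integral_cheb_U[of "monom 1 k" k] by (simp add: degree_monom_eq poly_monom)
  thus ?thesis
    using k by (subst integral_mu_combination) (simp_all only: order_refl if_True simp_thms power_add, simp)
qed

context
  assumes supp: "\<And>i j. coeff2 P i j \<noteq> 0 \<Longrightarrow> j \<le> m \<and> (lex_less (i, j) (r, k) \<or> (i, j) = (r, k))"
begin

lemma combination_norm: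
  "(\<integral>(x, y). (poly2 P x y)\<^sup>2 \<partial>mu N a) = coeff2 P r k * (\<alpha> 0 / 2 ^ (r + k))"
proof -
  have "(\<integral>(x, y). poly2 P x y * poly2 P x y \<partial>mu N a) =
      coeff2 P r k * (\<integral>(x, y). poly2 P x y * (x ^ r * y ^ k) \<partial>mu N a)"
    by (rule integral_mu_poly2[OF _ supp combination_orthogonal k])
       (auto simp: case_prod_unfold intro!: continuous_intros)
  thus ?thesis by (simp add: combination_leading power2_eq_square)
qed

text \<open>The powers of 2 cancel in \<open>combination_norm\<close>, so unit norm becomes
  \<open>\<gamma> * \<alpha> 0 = 1\<close>.\<close>

lemma is_lex_op_combination:
  assumes "coeff2 P r k = \<gamma> * 2 ^ (r + k)" "\<gamma> > 0" "\<gamma> * \<alpha> 0 = 1"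
  shows "is_lex_op (mu N a) m r k P"
  unfolding is_lex_op_def combination_norm
  using supp combination_orthogonal assms by auto

end

end

text \<open>This is q_r(x,y) U_k(y), expanded so that its monomials can be bounded.\<close>

definition op_low :: "nat \<Rightarrow> nat \<Rightarrow> real poly poly" where
  "op_low r k = (\<Sum>p\<le>N. \<Sum>p'\<le>N. smult [:coeff (omega_poly N a) p * coeff (omega_poly N a) p':]
     (tensor (cheb_U (int r - int p - int p')) (cheb_U (int k + int p - int p'))))"

lemma poly2_op_low: "poly2 (op_low r k) x y = q N a r x y * U k y"
  by (simp add: op_low_def poly2_sum poly2_smult poly2_tensor q_mult_cheb_U del: smult_pCons)

text \<open>As r >= 2N, all indices in x are nonnegative, so x-degree r occurs only for p = p' = 0,
  where the y-degree is at most k. Otherwise the y-degree is at most k + N <= m, or at most N - 2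
  when the index in y is negative.\<close>

lemma is_lex_op_op_low:
  assumes "2 * N \<le> r" "k + N \<le> m" "N < m"
  shows "is_lex_op (mu N a) m r k (op_low r k)"
proof -
  let ?e = "coeff (omega_poly N a)"
  have co: "coeff2 (op_low r k) i j = (\<Sum>p\<le>N. \<Sum>p'\<le>N. ?e p * ?e p' *
      (coeff (cheb_U (int r - int p - int p')) i * coeff (cheb_U (int k + int p - int p')) j))" for i j
    by (simp add: op_low_def coeff2_sum coeff2_smult coeff2_tensor del: smult_pCons)
  have bnd: "int i \<le> int r - int p - int p'" "int j \<le> max (int k + int p - int p') (- (int k + int p - int p') - 2)"
    if "coeff (cheb_U (int r - int p - int p')) i \<noteq> 0" "coeff (cheb_U (int k + int p - int p')) j \<noteq> 0"
      "p \<le> N" "p' \<le> N" for i j p p'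
    using coeff_cheb_U_nz[OF that(1)] coeff_cheb_U_nz[OF that(2)] that assms by linarith+
  show ?thesis
  \<comment> \<open>The degenerate combination with a single \<open>q\<close> term;
    \<open>\<beta>\<close> is zero, so the choice of \<open>v\<close> is immaterial.\<close>
  proof (rule is_lex_op_combination[where D = 1 and \<alpha> = "\<lambda>_. 1" and \<beta> = "\<lambda>_. 0" and \<gamma> = 1 and v = "\<lambda>_. 0"])
    fix i j assume "coeff2 (op_low r k) i j \<noteq> 0"
    then obtain p p' where pp: "p \<le> N" "p' \<le> N" "coeff (cheb_U (int r - int p - int p')) i \<noteq> 0"
      "coeff (cheb_U (int k + int p - int p')) j \<noteq> 0"
      unfolding co by (auto elim!: sum.not_neutral_contains_not_neutral)
    show "j \<le> m \<and> (lex_less (i, j) (r, k) \<or> (i, j) = (r, k))"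
    proof (cases "p = 0 \<and> p' = 0")
      case True
      thus ?thesis using bnd[OF pp(3,4,1,2)] assms by (auto simp: lex_less_def)
    next
      case False
      have "i < r" "j \<le> m" using False bnd[OF pp(3,4,1,2)] assms pp(1,2) by linarith+
      thus ?thesis by (simp add: lex_less_def)
    qed
  next
    have "coeff2 (op_low r k) r k = (\<Sum>p\<le>N. \<Sum>p'\<le>N. if p' = 0 then if p = 0 then 2 ^ (r + k) else 0 else 0)"
      unfolding co
    proof (intro sum.cong refl)
      fix p p' assume "p \<in> {..N}" "p' \<in> {..N}"
      hence "coeff (cheb_U (int r - int p - int p')) r * coeff (cheb_U (int k + int p - int p')) k = 0"
        if "\<not> (p = 0 \<and> p' = 0)"
        using bnd(1)[of p p' r k] that by fastforce
      thus "?e p * ?e p' * (coeff (cheb_U (int r - int p - int p')) r * coeff (cheb_U (int k + int p - int p')) k) =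
          (if p' = 0 then if p = 0 then 2 ^ (r + k) else 0 else 0)"
        by (cases "p = 0 \<and> p' = 0") (auto simp: coeff_omega_poly_0 coeff_cheb_U_top power_add)
    qed
    thus "coeff2 (op_low r k) r k = 1 * 2 ^ (r + k)" by simp
  qed (use assms in \<open>auto simp: poly2_op_low\<close>)
qed

end

section \<open>The case k > m - N, with s = m - k\<close>

context bernstein_szego_nondegenerate
begin

text \<open>The sum over e_p and f_l from the idea of the proof, with l already confined to the
  range that the support condition allows.\<close>

definition op_high :: "nat \<Rightarrow> (nat \<Rightarrow> real) \<Rightarrow> nat \<Rightarrow> nat \<Rightarrow> real poly poly" where
  "op_high s f r k = (\<Sum>p\<le>N. \<Sum>l\<le>s. smult [:e p * f l:]
     (tensor (cheb_U (int r - int p - int l)) (cheb_U (int k - int p + int l))))"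

lemma coeff2_op_high: "coeff2 (op_high s f r k) i j = (\<Sum>p\<le>N. \<Sum>l\<le>s. e p * f l *
      (coeff (cheb_U (int r - int p - int l)) i * coeff (cheb_U (int k - int p + int l)) j))"
  by (simp add: op_high_def coeff2_sum coeff2_smult coeff2_tensor del: smult_pCons)

text \<open>Expanded by \<open>q_mult_cheb_U\<close>, all terms are sums over the same Chebyshev
  products. Collecting them produces the coefficients of \<open>bezout_comb\<close>, and
  \<open>G\<close> cuts the range of l to 0, ..., s.\<close>

lemma poly2_op_high:
  assumes "s < N"
    and G: "\<And>n. n < N - s - 1 \<or> n \<ge> N \<Longrightarrow> coeff (bezout_comb N a (N - s) \<alpha> \<beta>) n = 0"
  shows "poly2 (op_high s (\<lambda>l. coeff (bezout_comb N a (N - s) \<alpha> \<beta>) (l + (N - s - 1))) r k) x y =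
    (\<Sum>j<N - s. \<alpha> j * q N a (r + j) x y * U (int k - int j) y +
      \<beta> j * qt N a (k + s + 1 + j) x y * U (int r - int s - 1 - int j) x)"
proof -
  define d where "d = N - s"
  \<comment> \<open>\<open>T p' n\<close> is the product attached to degree n; the exponent l = n -
    d + 1 is taken in the integers since it may be negative.\<close>
  define T where "T = (\<lambda>p' n. U (int r - int p' - (int n - int d + 1)) x * U (int k - int p' + (int n - int d + 1)) y)"
  let ?g = "coeff (bezout_comb N a d \<alpha> \<beta>)"
  have d: "d > 0" "s + (d - 1) = N - 1" "int N = int d + int s" using assms(1) by (auto simp: d_def)
  \<comment> \<open>A \<open>q\<close> term has l = p - j, a \<open>qt\<close> term l = s + 1 + j -
    p; adding d - 1 gives the second arguments of \<open>T\<close>, because s + d = N.\<close>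
  have q: "q N a (r + j) x y * U (int k - int j) y = (\<Sum>p'\<le>N. \<Sum>p\<le>N. e p' * (e p * T p' (d - 1 - j + p)))"
    if "j < d" for j
    unfolding q_mult_cheb_U using that
    by (subst sum.swap, intro sum.cong refl) (simp add: T_def of_nat_diff algebra_simps)
  have qt: "qt N a (k + s + 1 + j) x y * U (int r - int s - 1 - int j) x =
      (\<Sum>p'\<le>N. \<Sum>p\<le>N. e p' * (e p * T p' (j + N - p)))" for j
    unfolding qt_eq_q q_mult_cheb_U using d
    by (subst sum.swap, intro sum.cong refl) (simp add: T_def of_nat_diff algebra_simps)
  have "(\<Sum>j<d. \<alpha> j * q N a (r + j) x y * U (int k - int j) y +
      \<beta> j * qt N a (k + s + 1 + j) x y * U (int r - int s - 1 - int j) x) =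
      (\<Sum>j<d. \<Sum>p'\<le>N. \<Sum>p\<le>N. e p' * (e p * (\<alpha> j * T p' (d - 1 - j + p) + \<beta> j * T p' (j + N - p))))"
  proof (intro sum.cong refl)
    fix j assume "j \<in> {..<d}"
    hence j: "j < d" by simp
    show "\<alpha> j * q N a (r + j) x y * U (int k - int j) y +
        \<beta> j * qt N a (k + s + 1 + j) x y * U (int r - int s - 1 - int j) x =
        (\<Sum>p'\<le>N. \<Sum>p\<le>N. e p' * (e p * (\<alpha> j * T p' (d - 1 - j + p) + \<beta> j * T p' (j + N - p))))"
      unfolding mult.assoc q[OF j] qt
      by (simp add: sum_distrib_left distrib_left sum.distrib mult.left_commute)
  qed
  also have "\<dots> = (\<Sum>p'\<le>N. e p' * (\<Sum>n\<le>N + d - 1. ?g n * T p' n))"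
    unfolding sum.swap[of _ "{..N}" "{..<d}"] sum_coeff_bezout_comb[OF refl] by (simp add: sum_distrib_left)
  also have "\<dots> = (\<Sum>p'\<le>N. e p' * (\<Sum>l\<le>s. ?g (l + (d - 1)) * T p' (l + (d - 1))))"
  proof (rule sum.cong[OF refl])
    fix p'
    \<comment> \<open>As s + (d - 1) = N - 1, exactly the degrees from d - 1 to N - 1
      remain.\<close>
    have "?g n = 0" if "n \<notin> {0+(d-1)..s+(d-1)}" for n
    proof -
      have "n < d - 1 \<or> n \<ge> N" using that d by auto
      thus ?thesis using G[of n] unfolding d_def by simp
    qed
    hence "(\<Sum>n\<le>N + d - 1. ?g n * T p' n) = (\<Sum>n=0+(d-1)..s+(d-1). ?g n * T p' n)"
      using d by (intro sum.mono_neutral_right) auto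
    also have "\<dots> = (\<Sum>l\<le>s. ?g (l + (d - 1)) * T p' (l + (d - 1)))"
      unfolding sum.shift_bounds_cl_nat_ivl by (simp add: atLeast0AtMost)
    finally show "e p' * (\<Sum>n\<le>N + d - 1. ?g n * T p' n) = e p' * (\<Sum>l\<le>s. ?g (l + (d - 1)) * T p' (l + (d - 1)))"
      by (rule arg_cong)
  qed
  also have "\<dots> = poly2 (op_high s (\<lambda>l. ?g (l + (d - 1))) r k) x y"
  proof -
    have "T p' (l + (d - 1)) = U (int r - int p' - int l) x * U (int k - int p' + int l) y" for p' l
      using d by (simp add: T_def of_nat_diff)
    thus ?thesis
      by (simp add: op_high_def poly2_sum poly2_smult poly2_tensor sum_distrib_left mult_ac del: smult_pCons)
  qed
  finally show ?thesis unfolding d_def by simp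
qed

context
  fixes s m r k :: nat
  assumes s: "s < N" and m: "2 * N < m" and r: "2 * N \<le> r" and k: "k + s = m"
begin

text \<open>Here p + l < 2N <= r and k - p + l >= m - s - N > 0, so both indices are positive and
  each degree is the index itself.\<close>

lemma op_high_bounds:
  assumes "coeff (cheb_U (int r - int p - int l)) i * coeff (cheb_U (int k - int p + int l)) j \<noteq> 0"
    "p \<le> N" "l \<le> s"
  shows "int i \<le> int r - int p - int l" "int j \<le> int k - int p + int l"
  using assms coeff_cheb_U_nz[of "int r - int p - int l" i] coeff_cheb_U_nz[of "int k - int p + int l" j] s m r k
  by auto

text \<open>The y-degree is at most k + s = m, and x-degree r forces p = l = 0.\<close>

lemma op_high_support:
  assumes "coeff2 (op_high s f r k) i j \<noteq> 0"
  shows "j \<le> m \<and> (lex_less (i, j) (r, k) \<or> (i, j) = (r, k))"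
proof -
  obtain p l where pl: "p \<le> N" "l \<le> s"
    "coeff (cheb_U (int r - int p - int l)) i * coeff (cheb_U (int k - int p + int l)) j \<noteq> 0"
    using assms unfolding coeff2_op_high by (auto elim!: sum.not_neutral_contains_not_neutral)
  note b = op_high_bounds[OF pl(3,1,2)]
  have "i \<le> r" "j \<le> m" "i = r \<Longrightarrow> j \<le> k" using b pl k by linarith+
  thus ?thesis by (auto simp: lex_less_def)
qed

lemma op_high_leading: "coeff2 (op_high s f r k) r k = f 0 * 2 ^ (r + k)"
proof -
  have "coeff2 (op_high s f r k) r k = (\<Sum>p\<le>N. \<Sum>l\<le>s. if l = 0 then if p = 0 then f 0 * 2 ^ (r + k) else 0 else 0)"
    unfolding coeff2_op_high
  proof (intro sum.cong refl)
    fix p l assume "p \<in> {..N}" "l \<in> {..s}"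
    hence "coeff (cheb_U (int r - int p - int l)) r * coeff (cheb_U (int k - int p + int l)) k = 0"
      if "\<not> (p = 0 \<and> l = 0)"
      using op_high_bounds(1)[of p l r k] that by fastforce
    thus "e p * f l * (coeff (cheb_U (int r - int p - int l)) r * coeff (cheb_U (int k - int p + int l)) k) =
        (if l = 0 then if p = 0 then f 0 * 2 ^ (r + k) else 0 else 0)"
      by (cases "p = 0 \<and> l = 0") (auto simp: coeff_omega_poly_0 coeff_cheb_U_top power_add)
  qed
  thus ?thesis by simp
qed

text \<open>Only the last nonzero \<open>f L\<close> contributes to the top power \<open>y\<^sup>k\<^sup>+\<^sup>L\<close>.\<close>

lemma op_high_nonzero:
  assumes "l \<le> s" "f l \<noteq> 0"
  shows "op_high s f r k \<noteq> 0"
proof -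
  define L where "L = Max {l. l \<le> s \<and> f l \<noteq> 0}"
  have fin: "finite {l. l \<le> s \<and> f l \<noteq> 0}" by simp
  have "L \<in> {l. l \<le> s \<and> f l \<noteq> 0}" unfolding L_def using assms fin by (intro Max_in) auto
  hence L: "L \<le> s" "f L \<noteq> 0" by auto
  have max: "f l = 0" if "l > L" "l \<le> s" for l
  proof (rule ccontr)
    assume "f l \<noteq> 0"
    hence "l \<le> L" unfolding L_def using that(2) by (intro Max_ge[OF fin]) simp
    thus False using that(1) by simp
  qed
  have Lr: "L \<le> r" using L s r by simp
  have "coeff2 (op_high s f r k) (r - L) (k + L) =
      (\<Sum>p\<le>N. \<Sum>l\<le>s. if l = L then if p = 0 then f L * (2 ^ (r - L) * 2 ^ (k + L)) else 0 else 0)"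
    unfolding coeff2_op_high
  proof (intro sum.cong refl)
    fix p l assume pl: "p \<in> {..N}" "l \<in> {..s}"
    have top: "coeff (cheb_U (int r - int L)) (r - L) = 2 ^ (r - L)"
      "coeff (cheb_U (int k + int L)) (k + L) = 2 ^ (k + L)"
      using coeff_cheb_U_top[of "r - L"] coeff_cheb_U_top[of "k + L"] Lr by (simp_all add: of_nat_diff)
    show "e p * f l * (coeff (cheb_U (int r - int p - int l)) (r - L) * coeff (cheb_U (int k - int p + int l)) (k + L)) =
        (if l = L then if p = 0 then f L * (2 ^ (r - L) * 2 ^ (k + L)) else 0 else 0)"
    proof (cases "coeff (cheb_U (int r - int p - int l)) (r - L) * coeff (cheb_U (int k - int p + int l)) (k + L) = 0")
      case True
      thus ?thesis using top by auto
    next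
      case False
      from op_high_bounds(2)[OF False] pl have "L + p \<le> l" by simp
      hence "f l = 0 \<or> l = L \<and> p = 0" using max[of l] pl by fastforce
      thus ?thesis using top \<open>L + p \<le> l\<close> L by (auto simp: coeff_omega_poly_0)
    qed
  qed
  also have "\<dots> = f L * (2 ^ (r - L) * 2 ^ (k + L))" using L by simp
  finally show ?thesis using L by (auto simp: coeff2_def)
qed

end

text \<open>The product of f_0 and \<alpha>_0 is the squared norm of a nonzero polynomial, hence
  positive, and scaling by c multiplies it by c^2. It depends only on s, so computing it at one
  sample of r, m, k is enough.\<close>

lemma bezout_comb_normalized:
  assumes s: "s < N"
  shows "\<exists>\<alpha> \<beta>. (\<forall>n. n < N - s - 1 \<or> n \<ge> N \<longrightarrow> coeff (bezout_comb N a (N - s) \<alpha> \<beta>) n = 0) \<and>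
    coeff (bezout_comb N a (N - s) \<alpha> \<beta>) (N - s - 1) > 0 \<and>
    coeff (bezout_comb N a (N - s) \<alpha> \<beta>) (N - s - 1) * \<alpha> 0 = 1"
proof -
  obtain \<alpha> \<beta> where nz: "bezout_comb N a (N - s) \<alpha> \<beta> \<noteq> 0"
    and G: "\<And>n. n < N - s - 1 \<or> n \<ge> N \<Longrightarrow> coeff (bezout_comb N a (N - s) \<alpha> \<beta>) n = 0"
    using bezout_comb_kernel[of "N - s"] s by auto
  define f where "f = (\<lambda>l. coeff (bezout_comb N a (N - s) \<alpha> \<beta>) (l + (N - s - 1)))"
  \<comment> \<open>Any admissible values serve as the sample; these are the smallest r and
    m.\<close>
  define r m k where "r = 2 * N" and "m = 2 * N + 1" and "k = 2 * N + 1 - s"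
  have h: "2 * N < m" "2 * N \<le> r" "k + s = m" "k \<le> m" using s by (auto simp: r_def m_def k_def)
  define P where "P = op_high s f r k"
  have "\<exists>n. coeff (bezout_comb N a (N - s) \<alpha> \<beta>) n \<noteq> 0" using nz by (simp add: poly_eq_iff)
  then obtain n where n: "coeff (bezout_comb N a (N - s) \<alpha> \<beta>) n \<noteq> 0" by blast
  with G[of n] have "\<not> n < N - s - 1" "n < N" by (blast, meson not_le)
  \<comment> \<open>The nonzero coefficient sits between degrees N - s - 1 and N - 1, that is, at
    some l in 0, ..., s.\<close>
  hence "f (n - (N - s - 1)) \<noteq> 0" "n - (N - s - 1) \<le> s" using n s by (auto simp: f_def)
  hence "P \<noteq> 0" unfolding P_def using op_high_nonzero[OF s h(1,2,3)] by blast
  define I where "I = (\<integral>(x, y). (poly2 P x y)\<^sup>2 \<partial>mu N a)"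
  have "I \<noteq> 0" unfolding I_def using \<open>P \<noteq> 0\<close> integral_mu_square_eq_0 by blast
  moreover have "I \<ge> 0"
    unfolding I_def by (intro Bochner_Integration.integral_nonneg) auto
  ultimately have "I > 0" by linarith
  moreover have "I = coeff2 P r k * (\<alpha> 0 / 2 ^ (r + k))"
    unfolding I_def
  proof (rule combination_norm[OF _ _ h(4)])
    show "poly2 P x y = (\<Sum>j<N - s. \<alpha> j * q N a (r + j) x y * U (int k - int j) y +
      \<beta> j * qt N a (m + 1 + j) x y * U (int r - int s - 1 - int j) x)" for x y
      unfolding P_def f_def using poly2_op_high[OF s G, of r k x y] h(3) by simp
  qed (use s op_high_support[OF s h(1,2,3)] in \<open>auto simp: P_def\<close>)
  moreover have "coeff2 P r k = f 0 * 2 ^ (r + k)"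
    unfolding P_def by (rule op_high_leading[OF s h(1,2,3)])
  ultimately have pos: "f 0 * \<alpha> 0 > 0" by simp
  \<comment> \<open>The square root makes the product 1; the sign makes c f_0 positive, as a leading
    coefficient must be.\<close>
  define c where "c = sgn (f 0) / sqrt (f 0 * \<alpha> 0)"
  have f0: "f 0 \<noteq> 0" "\<alpha> 0 \<noteq> 0" using pos by auto
  have "c * f 0 = \<bar>f 0\<bar> / sqrt (f 0 * \<alpha> 0)" by (simp add: c_def sgn_if)
  hence "c * f 0 > 0" using pos f0 by simp
  moreover have "c * f 0 * (c * \<alpha> 0) = 1"
  proof -
    have "c * f 0 * (c * \<alpha> 0) = (sgn (f 0))\<^sup>2 * (f 0 * \<alpha> 0) / (sqrt (f 0 * \<alpha> 0))\<^sup>2"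
      by (simp add: c_def power2_eq_square)
    also have "\<dots> = 1" using pos f0 by (auto simp: sgn_if)
    finally show ?thesis .
  qed
  ultimately show ?thesis
    using G by (intro exI[of _ "\<lambda>j. c * \<alpha> j"] exI[of _ "\<lambda>j. c * \<beta> j"]) (simp add: bezout_comb_scale f_def)
qed

text \<open>The constants are chosen for each s < N before m, r and k, so they depend on m - k
  alone. \<open>is_lex_op\<close> stays in the conclusion because the reverse family is identified
  through it.\<close>

lemma op_lex_formula:
  "\<exists>A B. \<forall>m r k. 2 * N < m \<longrightarrow> 2 * N \<le> r \<longrightarrow> k \<le> m \<longrightarrow>
    is_lex_op (mu N a) m r k (op_lex N a m r k) \<and> (\<forall>x y. poly2 (op_lex N a m r k) x y =
      (if k \<le> m - N then q N a r x y * U (int k) y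
       else (\<Sum>j=0..k - (m - N) - 1.
              A (m - k) j * q N a (r + j) x y * U (int k - int j) y
            + B (m - k) j * qt N a (m + 1 + j) x y * U (int r + int k - int m - 1 - int j) x)))"
proof -
  define good where "good s \<alpha> \<beta> \<longleftrightarrow> (\<forall>n. n < N - s - 1 \<or> n \<ge> N \<longrightarrow> coeff (bezout_comb N a (N - s) \<alpha> \<beta>) n = 0) \<and>
    coeff (bezout_comb N a (N - s) \<alpha> \<beta>) (N - s - 1) > 0 \<and>
    coeff (bezout_comb N a (N - s) \<alpha> \<beta>) (N - s - 1) * \<alpha> 0 = 1" for s \<alpha> \<beta>
  have "\<exists>\<alpha> \<beta>. good s \<alpha> \<beta>" if "s < N" for s
    unfolding good_def by (rule bezout_comb_normalized[OF that])
  then obtain A B where g: "\<And>s. s < N \<Longrightarrow> good s (A s) (B s)" by metis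
  have AB: "n < N - s - 1 \<or> n \<ge> N \<Longrightarrow> coeff (bezout_comb N a (N - s) (A s) (B s)) n = 0"
    "coeff (bezout_comb N a (N - s) (A s) (B s)) (N - s - 1) > 0"
    "coeff (bezout_comb N a (N - s) (A s) (B s)) (N - s - 1) * A s 0 = 1" if "s < N" for s n
    using g[OF that] unfolding good_def by blast+
  have main: "is_lex_op (mu N a) m r k (op_lex N a m r k) \<and> (\<forall>x y. poly2 (op_lex N a m r k) x y =
      (if k \<le> m - N then q N a r x y * U (int k) y
       else (\<Sum>j=0..k - (m - N) - 1.
              A (m - k) j * q N a (r + j) x y * U (int k - int j) y
            + B (m - k) j * qt N a (m + 1 + j) x y * U (int r + int k - int m - 1 - int j) x)))"
    if m: "2 * N < m" and r: "2 * N \<le> r" and k: "k \<le> m" for m r k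
  proof (cases "k \<le> m - N")
    case True
    have "is_lex_op (mu N a) m r k (op_low r k)"
      using True m r by (intro is_lex_op_op_low) auto
    with op_lex_eqI[OF this k] True show ?thesis by (simp add: poly2_op_low)
  next
    case False
    define s where "s = m - k"
    have s: "s < N" "k + s = m" "N - s > 0" using False k m by (auto simp: s_def)
    \<comment> \<open>Since k > m - N, no subtraction truncates and the last index is N - s -
      1.\<close>
    have set: "{0..k - (m - N) - 1} = {..<N - s}" using False k m by (auto simp: s_def)
    have v: "int r + int k - int m - 1 - int j = int r - int s - 1 - int j" for j
      using s by simp
    let ?P = "op_high s (\<lambda>l. coeff (bezout_comb N a (N - s) (A s) (B s)) (l + (N - s - 1))) r k"
    have rep: "poly2 ?P x y = (\<Sum>j<N - s. A s j * q N a (r + j) x y * U (int k - int j) y +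
      B s j * qt N a (m + 1 + j) x y * U (int r - int s - 1 - int j) x)" for x y
      using poly2_op_high[OF s(1) AB(1)[OF s(1)], of r k x y] unfolding s(2) .
    \<comment> \<open>The value given for \<open>\<gamma>\<close> is f_0, stored in the shifted
      degree N - s - 1.\<close>
    have P: "is_lex_op (mu N a) m r k ?P"
      using op_high_support[OF s(1) m r s(2)] op_high_leading[OF s(1) m r s(2)] AB(2,3)[OF s(1)]
      by (intro is_lex_op_combination[OF rep s(3) k, where \<gamma> = "coeff (bezout_comb N a (N - s) (A s) (B s)) (N - s - 1)"]) auto
    show ?thesis
      by (simp only: op_lex_eqI[OF P k] P False rep set v s_def[symmetric] if_False simp_thms)
  qed
  show ?thesis
    by (intro exI[of _ A] exI[of _ B] allI impI) (rule main)
qed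

end

theorem theorem3p11:
  fixes N :: nat and a :: "nat \<Rightarrow> real"
  assumes "N \<ge> 1"
    and "\<And>i. i \<in> {1..N} \<Longrightarrow> 0 < \<bar>a i\<bar> \<and> \<bar>a i\<bar> < 1"
  shows "\<exists>(A :: nat \<Rightarrow> nat \<Rightarrow> real) (B :: nat \<Rightarrow> nat \<Rightarrow> real)
            (At :: nat \<Rightarrow> nat \<Rightarrow> real) (Bt :: nat \<Rightarrow> nat \<Rightarrow> real).
    \<forall>n m :: nat. n > 2*N \<and> m > 2*N \<longrightarrow>
      (\<forall>r k. 2*N \<le> r \<and> r \<le> n \<and> k \<le> m \<longrightarrow>
        (\<forall>x y. poly2 (op_lex N a m r k) x y =
          (if k \<le> m - N then q N a r x y * U (int k) y
           else (\<Sum>j=0..k - (m - N) - 1.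
                  A (m - k) j * q N a (r + j) x y * U (int k - int j) y
                + B (m - k) j * qt N a (m + 1 + j) x y
                    * U (int r + int k - int m - 1 - int j) x)))) \<and>
      (\<forall>t l. 2*N \<le> t \<and> t \<le> m \<and> l \<le> n \<longrightarrow>
        (\<forall>x y. poly2 (op_revlex N a n t l) x y =
          (if l \<le> n - N then qt N a t x y * U (int l) x
           else (\<Sum>j=0..l - (n - N) - 1.
                  At (n - l) j * qt N a (t + j) x y * U (int l - int j) x
                + Bt (n - l) j * q N a (n + 1 + j) x y
                    * U (int t + int l - int n - 1 - int j) y))))"
proof -
  interpret bernstein_szego_nondegenerate N a
    using assms(2) by unfold_locales auto
  obtain A B where AB: "\<forall>m r k. 2 * N < m \<longrightarrow> 2 * N \<le> r \<longrightarrow> k \<le> m \<longrightarrow>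
    is_lex_op (mu N a) m r k (op_lex N a m r k) \<and> (\<forall>x y. poly2 (op_lex N a m r k) x y =
      (if k \<le> m - N then q N a r x y * U (int k) y
       else (\<Sum>j=0..k - (m - N) - 1.
              A (m - k) j * q N a (r + j) x y * U (int k - int j) y
            + B (m - k) j * qt N a (m + 1 + j) x y * U (int r + int k - int m - 1 - int j) x)))"
    using op_lex_formula by (elim exE)
  note is_lex = AB[rule_format, THEN conjunct1] and lex = AB[rule_format, THEN conjunct2, rule_format]
  \<comment> \<open>Exchanging x with y and m, r, k with n, t, l carries the first family to the
    second, so the same \<open>A\<close> and \<open>B\<close> serve for the tilde constants.\<close>
  have revlex: "poly2 (op_revlex N a n t l) x y =
      (if l \<le> n - N then qt N a t x y * U (int l) x
       else (\<Sum>j=0..l - (n - N) - 1.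
              A (n - l) j * qt N a (t + j) x y * U (int l - int j) x
            + B (n - l) j * q N a (n + 1 + j) x y * U (int t + int l - int n - 1 - int j) y))"
    if h: "2 * N < n" "2 * N \<le> t" "l \<le> n" for n t l x y
  proof -
    have "poly2 (op_revlex N a n t l) x y = poly2 (op_lex N a n t l) y x"
      by (simp add: op_revlex_eqI[OF is_lex[OF h] h(3)] poly2_swap_xy)
    thus ?thesis unfolding lex[OF h] by (simp only: qt_eq_q)
  qed
  show ?thesis
    by (intro exI[of _ A] exI[of _ B] allI impI conjI; (rule lex revlex; simp))
qed

end
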